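(* The hyperplane section $M=0$ of $V$ decomposes, over $\mathbb{Q}(i)$, into the union of 16 smooth elliptic curves, all isomorphic to $y^2=x^3-x$.
   Context: Let $V \subset \mathbb{P}^8_{\mathbb{Q}}$, with homogeneous coordinates $[A:B:C:D:M:E:F:G:H]$, be the variety of $3\times 3$ magic squares of squares, i.e. the variety defined by requiring all rows, columns and the two main diagonals of the array with rows $(A^2,B^2,C^2)$, $(D^2,M^2,E^2)$, $(F^2,G^2,H^2)$ to have sum $3M^2$. Equivalently, $V$ is the complete intersection surface defined by the six quadrics $3A^2-2F^2-2G^2+H^2$, $3B^2-2F^2+G^2-2H^2$, $3C^2+F^2-2G^2-2H^2$, $3D^2+2F^2-G^2-4H^2$, $3E^2-4F^2-G^2+2H^2$, $3M^2-F^2-G^2-H^2$. *)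

theory Defs
  imports "HOL-Analysis.Analysis" "HOL-Library.Poly_Mapping" "HOL-Computational_Algebra.Polynomial"
begin

text \<open>
  Varieties over a subfield \<open>K\<close> of the complex numbers are represented classically: by their
  complex (geometric) points, together with the requirement that the defining equations, or the
  forms describing a morphism, have coefficients in \<open>K\<close>.

  A polynomial in the finitely many variables \<open>'v\<close> is a finitely supported map from exponent
  vectors to coefficients; multiplication is convolution.
\<close>

type_synonym 'v cpoly = "('v \<Rightarrow>\<^sub>0 nat) \<Rightarrow>\<^sub>0 complex"

definition Var :: "'v \<Rightarrow> 'v cpoly" where
  "Var i = Poly_Mapping.single (Poly_Mapping.single i 1) 1"

definition peval :: "'v::finite cpoly \<Rightarrow> complex ^ 'v \<Rightarrow> complex" where
  "peval f x = (\<Sum>m\<in>Poly_Mapping.keys f.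
     Poly_Mapping.lookup f m * (\<Prod>i\<in>UNIV. (x $ i) ^ Poly_Mapping.lookup m i))"

definition partial :: "'v::finite \<Rightarrow> 'v cpoly \<Rightarrow> 'v cpoly" where
  "partial i f = (\<Sum>m\<in>Poly_Mapping.keys f.
     Poly_Mapping.single (m - Poly_Mapping.single i 1)
       (of_nat (Poly_Mapping.lookup m i) * Poly_Mapping.lookup f m))"

definition homogeneous :: "nat \<Rightarrow> 'v::finite cpoly \<Rightarrow> bool" where
  "homogeneous d f \<longleftrightarrow>
     (\<forall>m\<in>Poly_Mapping.keys f. (\<Sum>i\<in>UNIV. Poly_Mapping.lookup m i) = d)"

definition coeffs_in :: "complex set \<Rightarrow> 'v cpoly \<Rightarrow> bool" where
  "coeffs_in K f \<longleftrightarrow> (\<forall>m\<in>Poly_Mapping.keys f. Poly_Mapping.lookup f m \<in> K)"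

definition cscale :: "complex \<Rightarrow> 'v cpoly \<Rightarrow> 'v cpoly" where
  "cscale c f = Poly_Mapping.single 0 c * f"

interpretation cpoly: vector_space cscale
  by unfold_locales
     (simp_all add: cscale_def distrib_left distrib_right single_add mult_single
        flip: mult.assoc)

text \<open>
  A point of the projective space with homogeneous coordinates indexed by \<open>'v\<close> is the set of
  all its homogeneous coordinate vectors.
\<close>

definition proj_point :: "complex ^ 'v \<Rightarrow> (complex ^ 'v) set" where
  "proj_point x = {c *s x | c. c \<noteq> 0}"

definition proj_space :: "(complex ^ 'v) set set" where
  "proj_space = proj_point ` {x. x \<noteq> 0}"

definition proj_zeros :: "'v::finite cpoly set \<Rightarrow> (complex ^ 'v) set set" where
  "proj_zeros S = {P \<in> proj_space. \<forall>f\<in>S. \<forall>x\<in>P. peval f x = 0}"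

definition proj_closed_over :: "complex set \<Rightarrow> (complex ^ 'v::finite) set set \<Rightarrow> bool" where
  "proj_closed_over K X \<longleftrightarrow>
     (\<exists>S. (\<forall>f\<in>S. coeffs_in K f \<and> (\<exists>d. homogeneous d f)) \<and> X = proj_zeros S)"

abbreviation proj_closed :: "(complex ^ 'v::finite) set set \<Rightarrow> bool" where
  "proj_closed \<equiv> proj_closed_over UNIV"

definition geom_irreducible :: "(complex ^ 'v::finite) set set \<Rightarrow> bool" where
  "geom_irreducible X \<longleftrightarrow> X \<noteq> {} \<and>
     (\<forall>Y Z. proj_closed Y \<and> proj_closed Z \<and> X \<subseteq> Y \<union> Z \<longrightarrow> X \<subseteq> Y \<or> X \<subseteq> Z)"

definition krull_dim :: "(complex ^ 'v::finite) set set \<Rightarrow> enat" where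
  "krull_dim X = Sup {enat n | n. \<exists>c :: nat \<Rightarrow> (complex ^ 'v) set set.
     (\<forall>i\<le>n. proj_closed (c i) \<and> geom_irreducible (c i) \<and> c i \<subseteq> X) \<and>
     (\<forall>i<n. c i \<subset> c (Suc i))}"

definition forms :: "nat \<Rightarrow> 'v::finite cpoly set" where
  "forms d = {f. homogeneous d f}"

definition vanishing_forms :: "(complex ^ 'v::finite) set set \<Rightarrow> nat \<Rightarrow> 'v cpoly set" where
  "vanishing_forms X d = {f \<in> forms d. \<forall>P\<in>X. \<forall>x\<in>P. peval f x = 0}"

text \<open>
  The tangent space of the affine cone over \<open>X\<close> at \<open>x\<close>. Its dimension exceeds the dimension of
  the Zariski tangent space of \<open>X\<close> at the corresponding projective point by one, so \<open>smooth\<close>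
  below is the Jacobian criterion.
\<close>

definition cone_tangent :: "(complex ^ 'v::finite) set set \<Rightarrow> complex ^ 'v \<Rightarrow> (complex ^ 'v) set" where
  "cone_tangent X x =
     {v. \<forall>d. \<forall>f\<in>vanishing_forms X d. (\<Sum>i\<in>UNIV. peval (partial i f) x * v $ i) = 0}"

definition smooth :: "(complex ^ 'v::finite) set set \<Rightarrow> bool" where
  "smooth X \<longleftrightarrow> (\<forall>P\<in>X. \<forall>x\<in>P. enat (vec.dim (cone_tangent X x)) = krull_dim X + 1)"

text \<open>
  The dimension of the degree \<open>d\<close> part of the homogeneous coordinate ring of \<open>X\<close>. The arithmetic
  genus of a curve with Hilbert polynomial \<open>p\<close> is \<open>1 - p(0)\<close>; for a smooth
  irreducible curve it is the genus.
\<close>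

definition hilbert_fun :: "(complex ^ 'v::finite) set set \<Rightarrow> nat \<Rightarrow> nat" where
  "hilbert_fun X d = cpoly.dim (forms d :: 'v cpoly set) - cpoly.dim (vanishing_forms X d)"

definition curve_genus :: "(complex ^ 'v::finite) set set \<Rightarrow> int \<Rightarrow> bool" where
  "curve_genus X g \<longleftrightarrow> (\<exists>p :: rat poly.
     (\<forall>\<^sub>F d in sequentially. of_nat (hilbert_fun X d) = poly p (of_nat d)) \<and>
     poly p 0 = 1 - of_int g)"

definition rational_point :: "complex set \<Rightarrow> (complex ^ 'v) set \<Rightarrow> bool" where
  "rational_point K P \<longleftrightarrow> (\<exists>x\<in>P. \<forall>i. x $ i \<in> K)"

definition elliptic_curve :: "complex set \<Rightarrow> (complex ^ 'v::finite) set set \<Rightarrow> bool" where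
  "elliptic_curve K X \<longleftrightarrow>
     proj_closed_over K X \<and> geom_irreducible X \<and> krull_dim X = 1 \<and> smooth X \<and>
     curve_genus X 1 \<and> (\<exists>P\<in>X. rational_point K P)"

text \<open>
  A map is a \<open>K\<close>-morphism if near every point it is given by forms of equal degree over \<open>K\<close>
  without common zero there. The neighbourhood is the set of points of \<open>X\<close> at which the forms do
  not vanish simultaneously.
\<close>

definition morphism_over ::
  "complex set \<Rightarrow> (complex ^ 'v::finite) set set \<Rightarrow> (complex ^ 'w::finite) set set \<Rightarrow>
     ((complex ^ 'v) set \<Rightarrow> (complex ^ 'w) set) \<Rightarrow> bool" where
  "morphism_over K X Y \<phi> \<longleftrightarrow> \<phi> ` X \<subseteq> Y \<and>
     (\<forall>P\<in>X. \<exists>d. \<exists>g :: 'w \<Rightarrow> 'v cpoly.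
        (\<forall>j. homogeneous d (g j) \<and> coeffs_in K (g j)) \<and>
        (\<forall>x\<in>P. (\<chi> j. peval (g j) x) \<noteq> 0) \<and>
        (\<forall>Q\<in>X. \<forall>x\<in>Q. (\<chi> j. peval (g j) x) \<noteq> 0 \<longrightarrow> \<phi> Q = proj_point (\<chi> j. peval (g j) x)))"

definition isomorphic_over ::
  "complex set \<Rightarrow> (complex ^ 'v::finite) set set \<Rightarrow> (complex ^ 'w::finite) set set \<Rightarrow> bool" where
  "isomorphic_over K X Y \<longleftrightarrow> (\<exists>\<phi> \<psi>. morphism_over K X Y \<phi> \<and> morphism_over K Y X \<psi> \<and>
     (\<forall>P\<in>X. \<psi> (\<phi> P) = P) \<and> (\<forall>Q\<in>Y. \<phi> (\<psi> Q) = Q))"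

definition gauss_rat :: "complex set" where
  "gauss_rat = {z. Re z \<in> \<rat> \<and> Im z \<in> \<rat>}"

datatype entry = eA | eB | eC | eD | eM | eE | eF | eG | eH

instance entry :: finite
proof
  have "UNIV = {eA, eB, eC, eD, eM, eE, eF, eG, eH}"
    by (auto intro: entry.exhaust)
  then show "finite (UNIV :: entry set)"
    by (metis finite.emptyI finite_insert)
qed

definition magic_line :: "entry \<Rightarrow> entry \<Rightarrow> entry \<Rightarrow> entry cpoly" where
  "magic_line a b c = Var a ^ 2 + Var b ^ 2 + Var c ^ 2 - 3 * Var eM ^ 2"

definition magic_variety :: "(complex ^ entry) set set" where
  "magic_variety = proj_zeros
    {magic_line eA eB eC, magic_line eD eM eE, magic_line eF eG eH,
     magic_line eA eD eF, magic_line eB eM eG, magic_line eC eE eH,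
     magic_line eA eM eH, magic_line eC eM eF}"

text \<open>
  The projective closure \<open>y\<^sup>2 z = x\<^sup>3 - x z\<^sup>2\<close> of the affine curve \<open>y\<^sup>2 = x\<^sup>3 - x\<close>; the indices
  \<open>1\<close>, \<open>2\<close>, \<open>3\<close> stand for \<open>x\<close>, \<open>y\<close>, \<open>z\<close>.
\<close>

definition weierstrass_curve :: "(complex ^ 3) set set" where
  "weierstrass_curve = proj_zeros {Var 2 ^ 2 * Var 3 - (Var 1 ^ 3 - Var 1 * Var 3 ^ 2)}"

end

theory Submission
  imports Defs
begin

text \<open>
  The magic square equations are linear in the squares of the entries, and for \<open>M = 0\<close> they reduce to
  \<open>B\<^sup>2 = -A\<^sup>2 - C\<^sup>2\<close>, \<open>D\<^sup>2 = C\<^sup>2 - A\<^sup>2\<close>, \<open>E\<^sup>2 = -D\<^sup>2\<close>, \<open>F\<^sup>2 = -C\<^sup>2\<close>, \<open>G\<^sup>2 = -B\<^sup>2\<close>, \<open>H\<^sup>2 = -A\<^sup>2\<close>.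
  The last four equations split: each of \<open>E\<close>, \<open>F\<close>, \<open>G\<close>, \<open>H\<close> is \<open>\<i>\<close> or \<open>-\<i>\<close> times an entry among
  \<open>A\<close>, \<open>B\<close>, \<open>C\<close>, \<open>D\<close>. The sixteen choices cut out sixteen copies, in sixteen linear subspaces, of the
  quartic space curve given by the first two equations.

  The duplication formula on \<open>y\<^sup>2 = x\<^sup>3 - x\<close> makes \<open>X\<close>, \<open>X - 1\<close> and \<open>X + 1\<close> squares for \<open>X = x (2P)\<close>,
  and this is exactly a parametrisation of that quartic:
  \<open>A = 2 y\<close>, \<open>C = x\<^sup>2 + 1\<close>, \<open>D = x\<^sup>2 - 2 x - 1\<close>, \<open>B = \<i> (x\<^sup>2 + 2 x - 1)\<close>.
  These are four independent linear combinations of \<open>1\<close>, \<open>x\<close>, \<open>y\<close>, \<open>x\<^sup>2\<close>, so each of the sixteen curves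
  is the image of the model \<open>(1 : x : y : x\<^sup>2)\<close> of the cubic under an injective matrix with entries in
  \<open>\<rat>(\<i>)\<close>. Everything is therefore proved for an arbitrary embedding of this kind (locale
  \<open>quartic_model\<close>).

  The algebra behind all the geometric statements is that a form of degree \<open>d\<close> restricts to the
  affine curve as \<open>p(x) + y q(x)\<close> with \<open>deg p \<le> 2 d\<close> and \<open>deg q \<le> 2 d - 2\<close> (\<open>form_restrictable\<close>). The
  pair \<open>(p, q)\<close> vanishes as soon as the form has infinitely many zeros on the curve, because the norm
  \<open>p\<^sup>2 - (x\<^sup>3 - x) q\<^sup>2\<close> of a nonzero pair is a nonzero polynomial (\<open>cubic_zeros_infinite_imp_zero\<close>). Hence
  proper closed subsets of the curve are finite, which gives irreducibility and dimension one; all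
  pairs within the degree bounds occur, so the Hilbert function is \<open>4 d\<close> for \<open>d > 0\<close> and the genus is \<open>1\<close>
  (\<open>hilbert_fun_quartic_curve\<close>); and a form vanishing on the curve is divisible by
  \<open>y\<^sup>2 - x\<^sup>3 + x\<close> after restriction, so that its gradient kills the tangent vector of the cubic, which
  leaves a tangent space of exactly the right dimension (\<open>cone_tangent_affine\<close>). The point at infinity
  needs no chart of its own: an automorphism of the quartic moves it into the affine part.
\<close>

section \<open>Evaluation, homogeneity and coefficients of forms\<close>

definition monom_eval :: "('v::finite \<Rightarrow>\<^sub>0 nat) \<Rightarrow> complex ^ 'v \<Rightarrow> complex" where
  "monom_eval m x = (\<Prod>i\<in>UNIV. (x $ i) ^ Poly_Mapping.lookup m i)"

lemma poly_mapping_sum_single: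
  "f = (\<Sum>m\<in>Poly_Mapping.keys f. Poly_Mapping.single m (Poly_Mapping.lookup f m))"
  by (rule poly_mapping_eqI)
     (simp add: lookup_sum lookup_single when_def in_keys_iff)

lemma peval_superset:
  assumes "finite A" "Poly_Mapping.keys f \<subseteq> A"
  shows "peval f x = (\<Sum>m\<in>A. Poly_Mapping.lookup f m * monom_eval m x)"
  unfolding peval_def monom_eval_def
  by (rule sum.mono_neutral_left) (use assms in \<open>auto simp: in_keys_iff\<close>)

lemma peval_zero [simp]: "peval 0 x = 0"
  by (simp add: peval_def)

lemma peval_add [simp]: "peval (f + g) x = peval f x + peval g x"
proof -
  let ?A = "Poly_Mapping.keys f \<union> Poly_Mapping.keys g"
  have "Poly_Mapping.keys (f + g) \<subseteq> ?A" by (rule keys_add)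
  then show ?thesis
    by (simp add: peval_superset[of ?A] lookup_add distrib_right sum.distrib)
qed

lemma peval_uminus [simp]: "peval (- f) x = - peval f x"
proof -
  have "peval (- f + f) x = 0" by simp
  then show ?thesis by (simp only: peval_add add_eq_0_iff2)
qed

lemma peval_diff [simp]: "peval (f - g) x = peval f x - peval g x"
  using peval_add[of f "- g" x] by simp

lemma peval_sum [simp]: "peval (\<Sum>i\<in>I. f i) x = (\<Sum>i\<in>I. peval (f i) x)"
  by (induction I rule: infinite_finite_induct) auto

lemma peval_single: "peval (Poly_Mapping.single m c) x = c * monom_eval m x"
  by (cases "c = 0") (auto simp: peval_def monom_eval_def)

lemma monom_eval_add: "monom_eval (m + n) x = monom_eval m x * monom_eval n x"
  by (simp add: monom_eval_def lookup_add power_add prod.distrib)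

lemma mult_sum_singles:
  "f * g = (\<Sum>m\<in>Poly_Mapping.keys f. \<Sum>n\<in>Poly_Mapping.keys g.
     Poly_Mapping.single (m + n) (Poly_Mapping.lookup f m * Poly_Mapping.lookup g n))"
  by (subst poly_mapping_sum_single[of f], subst poly_mapping_sum_single[of g])
     (simp add: sum_product mult_single)

lemma peval_mult [simp]: "peval (f * g) x = peval f x * peval g x"
  unfolding mult_sum_singles[of f g] peval_sum peval_single monom_eval_add
  by (simp add: peval_def sum_product mult_ac flip: monom_eval_def)

lemma peval_one [simp]: "peval 1 x = 1"
  using peval_single[of 0 1 x] by (simp add: monom_eval_def)

lemma peval_power [simp]: "peval (f ^ n) x = peval f x ^ n"
  by (induction n) auto

lemma peval_Var [simp]: "peval (Var i) x = x $ i"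
  by (simp add: Var_def peval_single monom_eval_def lookup_single when_def if_distrib cong: if_cong)

lemma peval_cscale [simp]: "peval (cscale c f) x = c * peval f x"
  by (simp add: cscale_def peval_single monom_eval_def)

lemma peval_numeral [simp]: "peval (numeral n) x = numeral n"
proof -
  have "peval (of_nat k) x = of_nat k" for k
    by (induction k) auto
  from this[of "numeral n"] show ?thesis by simp
qed

lemma homogeneous_zero [simp]: "homogeneous d 0"
  by (simp add: homogeneous_def)

lemma homogeneous_add: "homogeneous d f \<Longrightarrow> homogeneous d g \<Longrightarrow> homogeneous d (f + g)"
  using keys_add[of f g] unfolding homogeneous_def by blast

lemma homogeneous_sum: "(\<And>i. i \<in> I \<Longrightarrow> homogeneous d (f i)) \<Longrightarrow> homogeneous d (\<Sum>i\<in>I. f i)"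
  by (induction I rule: infinite_finite_induct) (auto intro: homogeneous_add)

lemma homogeneous_uminus: "homogeneous d f \<Longrightarrow> homogeneous d (- f)"
  by (auto simp: homogeneous_def in_keys_iff)

lemma homogeneous_diff: "homogeneous d f \<Longrightarrow> homogeneous d g \<Longrightarrow> homogeneous d (f - g)"
  using homogeneous_add[of d f "- g"] homogeneous_uminus[of d g] by simp

lemma homogeneous_mult:
  assumes "homogeneous d f" "homogeneous e g"
  shows "homogeneous (d + e) (f * g)"
  unfolding homogeneous_def
proof
  fix m assume "m \<in> Poly_Mapping.keys (f * g)"
  then obtain a b where "m = a + b" "a \<in> Poly_Mapping.keys f" "b \<in> Poly_Mapping.keys g"
    using keys_mult[of f g] by blast
  with assms show "(\<Sum>i\<in>UNIV. Poly_Mapping.lookup m i) = d + e"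
    by (auto simp: homogeneous_def lookup_add sum.distrib)
qed

lemma homogeneous_one [simp]: "homogeneous 0 1"
  by (simp add: homogeneous_def)

lemma homogeneous_const [simp]: "homogeneous 0 (Poly_Mapping.single 0 c)"
  by (simp add: homogeneous_def)

lemma homogeneous_power: "homogeneous d f \<Longrightarrow> homogeneous (n * d) (f ^ n)"
  by (induction n) (auto intro: homogeneous_mult)

lemma homogeneous_Var [simp]: "homogeneous 1 (Var i)"
  by (simp add: homogeneous_def Var_def lookup_single when_def)

lemma homogeneous_cscale: "homogeneous d f \<Longrightarrow> homogeneous d (cscale c f)"
  using homogeneous_mult[of 0 "Poly_Mapping.single 0 c" d f] by (simp add: cscale_def)

lemma peval_scale:
  assumes "homogeneous d f"
  shows "peval f (c *s x) = c ^ d * peval f x"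
proof -
  have "(\<Prod>i\<in>UNIV. (c * x $ i) ^ Poly_Mapping.lookup m i)
      = c ^ d * (\<Prod>i\<in>UNIV. (x $ i) ^ Poly_Mapping.lookup m i)"
    if "m \<in> Poly_Mapping.keys f" for m
    using that assms
    by (auto simp: homogeneous_def power_mult_distrib prod.distrib power_sum)
  then show ?thesis
    by (auto simp: peval_def sum_distrib_left mult_ac intro!: sum.cong)
qed

locale complex_subring =
  fixes K :: "complex set"
  assumes zero_mem [simp]: "0 \<in> K" and one_mem [simp]: "1 \<in> K"
    and add_mem: "a \<in> K \<Longrightarrow> b \<in> K \<Longrightarrow> a + b \<in> K"
    and mult_mem: "a \<in> K \<Longrightarrow> b \<in> K \<Longrightarrow> a * b \<in> K"
    and uminus_mem: "a \<in> K \<Longrightarrow> - a \<in> K"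
begin

lemma coeffs_in_zero [simp]: "coeffs_in K 0"
  by (simp add: coeffs_in_def)

lemma coeffs_in_iff: "coeffs_in K f \<longleftrightarrow> (\<forall>m. Poly_Mapping.lookup f m \<in> K)"
  by (metis coeffs_in_def in_keys_iff zero_mem)

lemma coeffs_in_add: "coeffs_in K f \<Longrightarrow> coeffs_in K g \<Longrightarrow> coeffs_in K (f + g)"
  by (simp add: coeffs_in_iff lookup_add add_mem)

lemma coeffs_in_uminus: "coeffs_in K f \<Longrightarrow> coeffs_in K (- f)"
  by (simp add: coeffs_in_iff uminus_mem)

lemma coeffs_in_diff: "coeffs_in K f \<Longrightarrow> coeffs_in K g \<Longrightarrow> coeffs_in K (f - g)"
  using coeffs_in_add[of f "- g"] by (simp add: coeffs_in_uminus)

lemma coeffs_in_sum: "(\<And>i. i \<in> I \<Longrightarrow> coeffs_in K (f i)) \<Longrightarrow> coeffs_in K (\<Sum>i\<in>I. f i)"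
  by (induction I rule: infinite_finite_induct) (auto intro: coeffs_in_add)

lemma coeffs_in_single: "c \<in> K \<Longrightarrow> coeffs_in K (Poly_Mapping.single m c)"
  by (simp add: coeffs_in_iff lookup_single when_def)

lemma coeffs_in_mult: "coeffs_in K f \<Longrightarrow> coeffs_in K g \<Longrightarrow> coeffs_in K (f * g)"
  unfolding mult_sum_singles[of f g]
  by (intro coeffs_in_sum coeffs_in_single mult_mem) (simp_all add: coeffs_in_iff)

lemma coeffs_in_power: "coeffs_in K f \<Longrightarrow> coeffs_in K (f ^ n)"
  by (induction n) (auto intro: coeffs_in_mult simp: coeffs_in_single simp flip: single_one)

lemma coeffs_in_Var [simp]: "coeffs_in K (Var i)"
  by (simp add: Var_def coeffs_in_single)

lemma coeffs_in_cscale: "c \<in> K \<Longrightarrow> coeffs_in K f \<Longrightarrow> coeffs_in K (cscale c f)"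
  by (simp add: cscale_def coeffs_in_mult coeffs_in_single)

end

text \<open>
  Differentiating along a parametrised arc turns every later statement about gradients of forms into a
  derivative in one variable.
\<close>

lemma peval_has_field_derivative:
  fixes \<gamma> :: "complex \<Rightarrow> complex ^ 'v::finite"
  assumes "\<And>i. ((\<lambda>t. \<gamma> t $ i) has_field_derivative v $ i) (at t)"
  shows "((\<lambda>t. peval f (\<gamma> t)) has_field_derivative
           (\<Sum>i\<in>UNIV. peval (partial i f) (\<gamma> t) * v $ i)) (at t)"
proof -
  let ?l = Poly_Mapping.lookup
  have mono: "((\<lambda>t. monom_eval m (\<gamma> t)) has_field_derivative
      (\<Sum>i\<in>UNIV. of_nat (?l m i) * monom_eval (m - Poly_Mapping.single i 1) (\<gamma> t) * v $ i)) (at t)"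
    for m
  proof -
    have "((\<lambda>t. \<Prod>i\<in>UNIV. (\<gamma> t $ i) ^ ?l m i) has_field_derivative
      (\<Sum>i\<in>UNIV. of_nat (?l m i) * (v $ i * (\<gamma> t $ i) ^ (?l m i - Suc 0)) *
          (\<Prod>j\<in>UNIV - {i}. (\<gamma> t $ j) ^ ?l m j))) (at t)"
      by (intro has_field_derivative_prod DERIV_power assms)
    moreover have "(\<gamma> t $ i) ^ (?l m i - Suc 0) * (\<Prod>j\<in>UNIV - {i}. (\<gamma> t $ j) ^ ?l m j)
        = monom_eval (m - Poly_Mapping.single i 1) (\<gamma> t)" for i
      unfolding monom_eval_def
      by (subst (2) prod.remove[of _ i]) (auto simp: lookup_minus lookup_single when_def intro!: prod.cong)
    ultimately show ?thesis
      by (simp only: monom_eval_def[of m] mult.assoc) (simp add: mult.commute[of "v $ _"] flip: mult.assoc)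
  qed
  have "peval (partial i f) (\<gamma> t) = (\<Sum>m\<in>Poly_Mapping.keys f. ?l f m *
      (of_nat (?l m i) * monom_eval (m - Poly_Mapping.single i 1) (\<gamma> t)))" for i
    by (simp add: partial_def peval_single mult_ac)
  then have "(\<Sum>i\<in>UNIV. peval (partial i f) (\<gamma> t) * v $ i) =
      (\<Sum>m\<in>Poly_Mapping.keys f. ?l f m *
        (\<Sum>i\<in>UNIV. of_nat (?l m i) * monom_eval (m - Poly_Mapping.single i 1) (\<gamma> t) * v $ i))"
    by (simp add: sum_distrib_right sum_distrib_left mult.assoc) (rule sum.swap)
  moreover have "((\<lambda>t. \<Sum>m\<in>Poly_Mapping.keys f. ?l f m * monom_eval m (\<gamma> t)) has_field_derivative
      (\<Sum>m\<in>Poly_Mapping.keys f. ?l f m *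
        (\<Sum>i\<in>UNIV. of_nat (?l m i) * monom_eval (m - Poly_Mapping.single i 1) (\<gamma> t) * v $ i))) (at t)"
    by (intro DERIV_sum DERIV_cmult mono)
  ultimately show ?thesis
    by (simp only: peval_def[of f] monom_eval_def)
qed

section \<open>Closed sets of projective space and the dimension of curves\<close>

lemma proj_point_self [simp]: "x \<in> proj_point x"
  unfolding proj_point_def by (auto intro!: exI[of _ 1])

lemma proj_point_eqI: "y \<in> proj_point x \<Longrightarrow> proj_point y = proj_point x"
proof -
  assume "y \<in> proj_point x"
  then obtain c where c: "c \<noteq> 0" "y = c *s x" by (auto simp: proj_point_def)
  show ?thesis
  proof (intro equalityI subsetI)
    fix z assume "z \<in> proj_point y"
    then obtain b where "b \<noteq> 0" "z = b *s y" by (auto simp: proj_point_def)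
    with c show "z \<in> proj_point x"
      by (auto simp: proj_point_def vector_smult_assoc intro!: exI[of _ "b * c"])
  next
    fix z assume "z \<in> proj_point x"
    then obtain b where "b \<noteq> 0" "z = b *s x" by (auto simp: proj_point_def)
    with c show "z \<in> proj_point y"
      by (auto simp: proj_point_def vector_smult_assoc intro!: exI[of _ "b / c"])
  qed
qed

lemma proj_point_smult: "c \<noteq> 0 \<Longrightarrow> proj_point (c *s x) = proj_point x"
  by (rule proj_point_eqI) (auto simp: proj_point_def)

lemma proj_point_mem_proj_space [simp]: "proj_point x \<in> proj_space \<longleftrightarrow> x \<noteq> 0"
proof
  assume "proj_point x \<in> proj_space"
  then obtain y where y: "y \<noteq> 0" "proj_point x = proj_point y" by (auto simp: proj_space_def)
  then have "x \<in> proj_point y" using proj_point_self[of x] by simp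
  with y(1) show "x \<noteq> 0" by (auto simp: proj_point_def vec_eq_iff)
qed (auto simp: proj_space_def)

lemma proj_spaceE:
  assumes "P \<in> proj_space" obtains x where "x \<noteq> 0" "P = proj_point x"
  using assms by (auto simp: proj_space_def)

lemma form_vanishes_at_proj_point:
  assumes "homogeneous d f"
  shows "(\<forall>y\<in>proj_point x. peval f y = 0) \<longleftrightarrow> peval f x = 0"
  using peval_scale[OF assms] proj_point_self[of x] by (auto simp: proj_point_def)

lemma proj_point_in_proj_zeros:
  assumes "\<And>f. f \<in> S \<Longrightarrow> \<exists>d. homogeneous d f"
  shows "proj_point x \<in> proj_zeros S \<longleftrightarrow> x \<noteq> 0 \<and> (\<forall>f\<in>S. peval f x = 0)"
proof -
  have "(\<forall>y\<in>proj_point x. peval f y = 0) \<longleftrightarrow> peval f x = 0" if "f \<in> S" for f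
    using assms[OF that] form_vanishes_at_proj_point by blast
  then show ?thesis by (auto simp: proj_zeros_def)
qed

lemma proj_closed_empty: "proj_closed ({} :: (complex ^ 'v::finite) set set)"
  unfolding proj_closed_over_def
proof (rule exI[of _ "{1}"], intro conjI ballI)
  have "P \<notin> proj_zeros {1}" for P :: "(complex ^ 'v) set"
  proof
    assume P: "P \<in> proj_zeros {1}"
    then obtain x where "P = proj_point x" by (auto simp: proj_zeros_def elim: proj_spaceE)
    then have "x \<in> P" by simp
    with P show False by (simp add: proj_zeros_def)
  qed
  then show "{} = proj_zeros {1 :: 'v cpoly}" by blast
qed (auto simp: coeffs_in_def intro: exI[of _ 0])

text \<open>
  The products \<open>f g\<close> define the union. Homogeneity is essential here: it lets both factors be evaluated
  at one and the same representative of a point.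
\<close>

lemma proj_closed_Un:
  fixes X Y :: "(complex ^ 'v::finite) set set"
  assumes "proj_closed X" "proj_closed Y"
  shows "proj_closed (X \<union> Y)"
proof -
  obtain S where S: "\<forall>f\<in>S. \<exists>d. homogeneous d f" "X = proj_zeros S"
    using assms(1) by (auto simp: proj_closed_over_def)
  obtain T where T: "\<forall>f\<in>T. \<exists>d. homogeneous d f" "Y = proj_zeros T"
    using assms(2) by (auto simp: proj_closed_over_def)
  let ?R = "{f * g | f g. f \<in> S \<and> g \<in> T}"
  have R: "\<exists>d. homogeneous d h" if "h \<in> ?R" for h
    using that S(1) T(1) homogeneous_mult by blast
  have "P \<in> X \<union> Y \<longleftrightarrow> P \<in> proj_zeros ?R" if P: "P \<in> proj_space" for P
  proof -
    obtain x where x: "x \<noteq> 0" "P = proj_point x" using P by (rule proj_spaceE)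
    have "P \<in> X \<longleftrightarrow> (\<forall>f\<in>S. peval f x = 0)"
      unfolding S(2) x(2) using x(1) S(1) by (subst proj_point_in_proj_zeros) blast+
    moreover have "P \<in> Y \<longleftrightarrow> (\<forall>f\<in>T. peval f x = 0)"
      unfolding T(2) x(2) using x(1) T(1) by (subst proj_point_in_proj_zeros) blast+
    moreover have "P \<in> proj_zeros ?R \<longleftrightarrow> (\<forall>h\<in>?R. peval h x = 0)"
      unfolding x(2) using x(1) R by (subst proj_point_in_proj_zeros) blast+
    moreover have "(\<forall>h\<in>?R. peval h x = 0) \<longleftrightarrow> (\<forall>f\<in>S. \<forall>g\<in>T. peval f x * peval g x = 0)"
      by (auto simp flip: peval_mult)
    ultimately show ?thesis by auto
  qed
  then have "X \<union> Y = proj_zeros ?R"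
    using S(2) T(2) by (auto simp: proj_zeros_def)
  with R show ?thesis
    unfolding proj_closed_over_def by (intro exI[of _ ?R]) (auto simp: coeffs_in_def)
qed

text \<open>
  A point is cut out by the \<open>2 \<times> 2\<close> minors of the matrix formed by its coordinates and the variables.
\<close>

lemma proj_closed_singleton:
  assumes "P \<in> proj_space" shows "proj_closed {P}"
proof -
  obtain x where x: "x \<noteq> 0" "P = proj_point x" using assms by (rule proj_spaceE)
  let ?S = "{cscale (x $ j) (Var i) - cscale (x $ i) (Var j) | i j. True}"
  have S: "homogeneous 1 f" if "f \<in> ?S" for f
    using that by (auto intro!: homogeneous_diff homogeneous_cscale homogeneous_Var[simplified])
  have "Q = P" if Q: "Q \<in> proj_zeros ?S" for Q
  proof -
    obtain y where y: "y \<noteq> 0" "Q = proj_point y"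
      using Q by (auto simp: proj_zeros_def elim: proj_spaceE)
    have *: "x $ j * y $ i = x $ i * y $ j" for i j
    proof -
      have "cscale (x $ j) (Var i) - cscale (x $ i) (Var j) \<in> ?S" by blast
      with Q y(2) have "peval (cscale (x $ j) (Var i) - cscale (x $ i) (Var j)) y = 0"
        unfolding proj_zeros_def using proj_point_self[of y] by blast
      then show ?thesis by (simp only: peval_diff peval_cscale peval_Var right_minus_eq)
    qed
    obtain j where j: "x $ j \<noteq> 0" using x by (auto simp: vec_eq_iff)
    have "y = (y $ j / x $ j) *s x"
      using *[of j] j by (auto simp: vec_eq_iff field_simps)
    then obtain c where c: "y = c *s x" by blast
    with y(1) have "c \<noteq> 0" by auto
    then show ?thesis unfolding x(2) y(2) c by (rule proj_point_smult)
  qed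
  moreover have "P \<in> proj_zeros ?S"
  proof -
    have "peval f x = 0" if "f \<in> ?S" for f using that by (auto simp: mult.commute)
    moreover have "\<exists>d. homogeneous d f" if "f \<in> ?S" for f using S[OF that] by blast
    ultimately show ?thesis
      unfolding x(2) using x(1) by (subst proj_point_in_proj_zeros) blast+
  qed
  ultimately have "{P} = proj_zeros ?S" by blast
  then show ?thesis
    unfolding proj_closed_over_def coeffs_in_def using S
    by (intro exI[of _ ?S] conjI ballI UNIV_I) blast+
qed

lemma proj_closed_finite:
  assumes "finite X" "X \<subseteq> proj_space" shows "proj_closed X"
  using assms
proof (induction X)
  case empty
  show ?case by (rule proj_closed_empty)
next
  case (insert P X)
  then show ?case using proj_closed_Un[of "{P}" X] proj_closed_singleton[of P] by simp
qed

lemma proj_closed_subset_proj_space: "proj_closed_over K X \<Longrightarrow> X \<subseteq> proj_space"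
  by (auto simp: proj_closed_over_def proj_zeros_def)

lemma geom_irreducible_singleton: "geom_irreducible {P}"
  by (auto simp: geom_irreducible_def)

lemma geom_irreducible_finite:
  assumes "geom_irreducible X" "finite X" "X \<subseteq> proj_space"
  obtains P where "X = {P}"
proof -
  obtain P where P: "P \<in> X" using assms(1) by (auto simp: geom_irreducible_def)
  have "proj_closed {P}" "proj_closed (X - {P})"
    using P assms by (auto intro!: proj_closed_finite)
  moreover have "X \<subseteq> {P} \<union> (X - {P})" by blast
  ultimately have "X \<subseteq> {P} \<or> X \<subseteq> X - {P}"
    using assms(1) unfolding geom_irreducible_def by blast
  with P that show ?thesis by blast
qed

text \<open>
  The only topological input about a curve is that a form which does not vanish identically on it has
  finitely many zeros there. This says that the Zariski topology of the curve is the cofinite one, from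
  which irreducibility and dimension follow without further algebra.
\<close>

locale cofinite_curve =
  fixes X :: "(complex ^ 'v::finite) set set"
  assumes infinite_curve: "infinite X"
    and curve_closed: "proj_closed X"
    and finite_form_zeros: "\<And>d f. homogeneous d f \<Longrightarrow> \<exists>P\<in>X. \<exists>x\<in>P. peval f x \<noteq> 0 \<Longrightarrow>
          finite {P \<in> X. \<forall>x\<in>P. peval f x = 0}"
begin

lemma finite_Int_closed:
  assumes "proj_closed Y" "\<not> X \<subseteq> Y" shows "finite (X \<inter> Y)"
proof -
  obtain S where S: "\<forall>f\<in>S. \<exists>d. homogeneous d f" "Y = proj_zeros S"
    using assms(1) by (auto simp: proj_closed_over_def)
  obtain P where "P \<in> X" "P \<notin> proj_zeros S" using assms(2) S(2) by blast
  then obtain f x where f: "f \<in> S" "x \<in> P" "peval f x \<noteq> 0"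
    using proj_closed_subset_proj_space[OF curve_closed] by (auto simp: proj_zeros_def)
  with S(1) \<open>P \<in> X\<close> have "finite {P \<in> X. \<forall>x\<in>P. peval f x = 0}"
    using finite_form_zeros by blast
  moreover have "X \<inter> Y \<subseteq> {P \<in> X. \<forall>x\<in>P. peval f x = 0}"
    using f(1) S(2) by (auto simp: proj_zeros_def)
  ultimately show ?thesis by (rule finite_subset[rotated])
qed

lemma irreducible: "geom_irreducible X"
  unfolding geom_irreducible_def
proof (intro conjI allI impI)
  show "X \<noteq> {}" using infinite_curve by auto
  fix Y Z assume YZ: "proj_closed Y \<and> proj_closed Z \<and> X \<subseteq> Y \<union> Z"
  show "X \<subseteq> Y \<or> X \<subseteq> Z"
  proof (rule ccontr)
    assume "\<not> (X \<subseteq> Y \<or> X \<subseteq> Z)"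
    then have "finite (X \<inter> Y)" "finite (X \<inter> Z)" using YZ finite_Int_closed by auto
    moreover have "X = (X \<inter> Y) \<union> (X \<inter> Z)" using YZ by blast
    ultimately show False using infinite_curve by (metis finite_UnI)
  qed
qed

text \<open>
  In a chain of length two inside \<open>X\<close> the middle member would be a proper closed subset, hence finite,
  hence a single point, and could not properly contain a nonempty set.
\<close>

lemma krull_dim_eq_1: "krull_dim X = 1"
proof -
  let ?chain = "\<lambda>n c. (\<forall>i\<le>n. proj_closed (c i) \<and> geom_irreducible (c i) \<and> c i \<subseteq> X) \<and>
     (\<forall>i<n. c i \<subset> c (Suc i))"
  have upper: "n \<le> 1" if c: "?chain n c" for n and c :: "nat \<Rightarrow> (complex ^ 'v) set set"
  proof (rule ccontr)
    assume "\<not> n \<le> 1"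
    then have le: "0 \<le> n" "1 \<le> n" "2 \<le> n" "0 < n" "1 < n" by auto
    note closed = conjunct1[OF c, rule_format] and less = conjunct2[OF c, rule_format]
    have "c 0 \<subset> c 1" "c 1 \<subset> c 2"
      using less[OF le(4)] less[OF le(5)] by (simp_all add: numeral_2_eq_2)
    note c' = this
    have "\<not> X \<subseteq> c 1" using c'(2) closed[OF le(3)] by blast
    then have "finite (X \<inter> c 1)" using closed[OF le(2)] finite_Int_closed by simp
    moreover have "X \<inter> c 1 = c 1" using closed[OF le(2)] by blast
    moreover have "c 1 \<subseteq> proj_space"
      using closed[OF le(2)] proj_closed_subset_proj_space by blast
    ultimately obtain P where P: "c 1 = {P}"
      using closed[OF le(2)] geom_irreducible_finite[of "c 1"] by metis
    have "c 0 \<subset> {P}" using c'(1) by (simp only: P)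
    then have "c 0 = {}" by (auto simp: psubset_eq subset_singleton_iff)
    with closed[OF le(1)] show False by (simp add: geom_irreducible_def)
  qed
  obtain P where P: "P \<in> X" using infinite_curve by fastforce
  have "X \<noteq> {P}" using infinite_curve by auto
  then have lt: "{P} \<subset> X" using P by blast
  have pt: "proj_closed {P}"
    using P proj_closed_subset_proj_space[OF curve_closed] by (intro proj_closed_singleton) blast
  let ?c = "\<lambda>i::nat. if i = 0 then {P} else X"
  have "proj_closed (?c i) \<and> geom_irreducible (?c i) \<and> ?c i \<subseteq> X" for i
    using P pt irreducible curve_closed by (simp add: geom_irreducible_singleton)
  moreover have "?c i \<subset> ?c (Suc i)" if "i < 1" for i
    using that lt by simp
  ultimately have chain: "?chain 1 ?c" by blast
  have "enat 1 \<in> {enat n | n. \<exists>c. ?chain n c}"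
    by (rule CollectI, rule exI, rule conjI[OF refl], rule exI, rule chain)
  moreover have "e \<le> enat 1" if e: "e \<in> {enat n | n. \<exists>c. ?chain n c}" for e
  proof -
    obtain n c where "e = enat n" "?chain n c"
      by (use e in \<open>elim CollectE exE conjE\<close>) (rule that; simp)
    then show ?thesis using upper[of n c] by simp
  qed
  ultimately show ?thesis
    unfolding krull_dim_def one_enat_def by (intro antisym Sup_least Sup_upper)
qed

end

section \<open>The quartic model of the cubic and the restriction of forms to it\<close>

definition vec4 :: "complex \<Rightarrow> complex \<Rightarrow> complex \<Rightarrow> complex \<Rightarrow> complex ^ 4" where
  "vec4 a b c d = (\<chi> i. if i = 1 then a else if i = 2 then b else if i = 3 then c else d)"

lemma vec4_nth [simp]:
  "vec4 a b c d $ 1 = a" "vec4 a b c d $ 2 = b" "vec4 a b c d $ 3 = c" "vec4 a b c d $ 4 = d"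
  by (simp_all add: vec4_def)

lemma vec4_eq_iff: "(u :: complex ^ 4) = v \<longleftrightarrow> u $ 1 = v $ 1 \<and> u $ 2 = v $ 2 \<and> u $ 3 = v $ 3 \<and> u $ 4 = v $ 4"
  by (simp add: vec_eq_iff forall_4)

text \<open>
  The affine cone over the image of the cubic under \<open>(x, y) \<mapsto> (1 : x : y : x\<^sup>2)\<close>, the embedding by the
  functions with a pole of order at most four at infinity. In these coordinates the equation
  \<open>y\<^sup>2 = x\<^sup>3 - x\<close> becomes the quadric \<open>y\<^sup>2 = x (x\<^sup>2 - 1)\<close>. The point at infinity is \<open>(0 : 0 : 0 : 1)\<close>.
\<close>

definition quartic_cone :: "(complex ^ 4) set" where
  "quartic_cone = {u. u $ 1 * u $ 4 = (u $ 2)\<^sup>2 \<and> (u $ 3)\<^sup>2 = u $ 2 * (u $ 4 - u $ 1)}"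

definition affine_vec :: "complex \<Rightarrow> complex \<Rightarrow> complex ^ 4" where
  "affine_vec x y = vec4 1 x y (x\<^sup>2)"

definition quartic_curve :: "complex ^ 4 ^ 'v::finite \<Rightarrow> (complex ^ 'v) set set" where
  "quartic_curve V = (\<lambda>u. proj_point (V *v u)) ` (quartic_cone - {0})"

lemma affine_vec_nth:
  "affine_vec x y $ 1 = 1" "affine_vec x y $ 2 = x" "affine_vec x y $ 3 = y" "affine_vec x y $ 4 = x\<^sup>2"
  by (simp_all add: affine_vec_def)

lemma affine_vec_in_cone: "y\<^sup>2 = x ^ 3 - x \<Longrightarrow> affine_vec x y \<in> quartic_cone"
  by (simp add: affine_vec_def quartic_cone_def power2_eq_square power3_eq_cube algebra_simps)

lemma affine_vec_nonzero [simp]: "affine_vec x y \<noteq> 0"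
  by (simp add: affine_vec_def vec4_eq_iff)

lemma smult_quartic_cone: "u \<in> quartic_cone \<Longrightarrow> c *s u \<in> quartic_cone"
  by (simp add: quartic_cone_def power_mult_distrib) (simp add: power2_eq_square algebra_simps)

lemma quartic_cone_cases:
  assumes "u \<in> quartic_cone" "u \<noteq> 0"
  obtains (affine) c x y where "c \<noteq> 0" "y\<^sup>2 = x ^ 3 - x" "u = c *s affine_vec x y"
  | (infinity) c where "c \<noteq> 0" "u = c *s vec4 0 0 0 1"
proof (cases "u $ 1 = 0")
  case True
  then have "u $ 2 = 0" "u $ 3 = 0" using assms by (auto simp: quartic_cone_def)
  with True assms have "u $ 4 \<noteq> 0" "u = (u $ 4) *s vec4 0 0 0 1" by (auto simp: vec4_eq_iff)
  then show ?thesis using infinity by blast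
next
  case False
  define x y where "x = u $ 2 / u $ 1" and "y = u $ 3 / u $ 1"
  have 4: "u $ 4 / u $ 1 = x\<^sup>2"
    using assms(1) False by (simp add: quartic_cone_def x_def field_simps power2_eq_square)
  have "y\<^sup>2 = x * (u $ 4 / u $ 1 - 1)"
    using assms(1) False by (simp add: quartic_cone_def x_def y_def power2_eq_square divide_simps)
  then have "y\<^sup>2 = x ^ 3 - x"
    by (simp add: 4 power2_eq_square power3_eq_cube algebra_simps)
  moreover have "u = (u $ 1) *s affine_vec x y"
    using False by (simp add: vec4_eq_iff affine_vec_def flip: 4) (simp add: x_def y_def)
  ultimately show ?thesis using affine False by blast
qed

text \<open>
  The automorphism \<open>P \<mapsto> T - P\<close> of the cubic for the 2-torsion point \<open>T = (1, 0)\<close>. In the coordinates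
  \<open>A\<close>, \<open>B\<close>, \<open>C\<close>, \<open>D\<close> of the magic square it is the sign change of \<open>D\<close>, hence linear and an involution. It
  exchanges the point at infinity with \<open>T\<close>.
\<close>

definition reflection :: "complex ^ 4 ^ 4" where
  "reflection = (\<chi> i. if i = 1 then vec4 (1/2) (-1) 0 (1/2) else if i = 2 then vec4 (-1/2) 0 0 (1/2)
     else if i = 3 then vec4 0 0 1 0 else vec4 (1/2) 1 0 (1/2))"

lemma reflection_mult_vec:
  "reflection *v u = vec4 ((u $ 1 + u $ 4) / 2 - u $ 2) ((u $ 4 - u $ 1) / 2) (u $ 3)
     ((u $ 1 + u $ 4) / 2 + u $ 2)"
  by (simp add: vec4_eq_iff reflection_def matrix_vector_mult_def sum_4 diff_divide_distrib add_divide_distrib)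

lemma reflection_involution: "reflection *v (reflection *v u) = u"
  by (simp add: reflection_mult_vec vec4_eq_iff field_simps)

lemma reflection_squared: "reflection ** reflection = mat 1"
  by (simp add: matrix_eq reflection_involution flip: matrix_vector_mul_assoc)

lemma reflection_in_cone: "u \<in> quartic_cone \<Longrightarrow> reflection *v u \<in> quartic_cone"
  unfolding quartic_cone_def mem_Collect_eq reflection_mult_vec vec4_nth
proof (elim conjE, intro conjI)
  assume u: "u $ 1 * u $ 4 = (u $ 2)\<^sup>2" "(u $ 3)\<^sup>2 = u $ 2 * (u $ 4 - u $ 1)"
  have "((u $ 1 + u $ 4) / 2 - u $ 2) * ((u $ 1 + u $ 4) / 2 + u $ 2)
      = ((u $ 4 - u $ 1) / 2)\<^sup>2 + (u $ 1 * u $ 4 - (u $ 2)\<^sup>2)"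
    by (simp add: power2_eq_square field_simps)
  with u(1) show "((u $ 1 + u $ 4) / 2 - u $ 2) * ((u $ 1 + u $ 4) / 2 + u $ 2)
      = ((u $ 4 - u $ 1) / 2)\<^sup>2" by simp
  show "(u $ 3)\<^sup>2 = (u $ 4 - u $ 1) / 2 * ((u $ 1 + u $ 4) / 2 + u $ 2 - ((u $ 1 + u $ 4) / 2 - u $ 2))"
    unfolding u(2) by simp
qed

lemma reflection_nonzero: "u \<noteq> 0 \<Longrightarrow> reflection *v u \<noteq> 0"
  by (metis reflection_involution matrix_vector_mult_0_right)

lemma quartic_curve_reflection: "quartic_curve (V ** reflection) = quartic_curve V"
proof -
  have "(*v) reflection ` (quartic_cone - {0}) = quartic_cone - {0}"
  proof (intro equalityI subsetI)
    fix u assume "u \<in> quartic_cone - {0}"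
    then have "reflection *v u \<in> quartic_cone - {0}"
      using reflection_in_cone reflection_nonzero by blast
    then show "u \<in> (*v) reflection ` (quartic_cone - {0})"
      by (rule rev_image_eqI) (simp add: reflection_involution)
  qed (use reflection_in_cone reflection_nonzero in auto)
  moreover have "quartic_curve (V ** reflection)
      = (\<lambda>u. proj_point (V *v u)) ` (*v) reflection ` (quartic_cone - {0})"
    by (simp add: quartic_curve_def image_image flip: matrix_vector_mul_assoc)
  ultimately show ?thesis by (simp add: quartic_curve_def)
qed

text \<open>
  Up to the reflection every point is affine, so statements at single points have to be proved on the
  affine part only.
\<close>

lemma quartic_cone_affine_cover:
  assumes "u \<in> quartic_cone" "u \<noteq> 0"
  obtains c x y where "c \<noteq> 0" "y\<^sup>2 = x ^ 3 - x"
    "u = c *s affine_vec x y \<or> u = c *s (reflection *v affine_vec x y)"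
  using assms
proof (cases rule: quartic_cone_cases)
  case (affine c x y)
  then show ?thesis using that by blast
next
  case (infinity c)
  have "u = (c / 2) *s (reflection *v affine_vec 1 0)"
    unfolding infinity(2) by (simp add: reflection_mult_vec affine_vec_def vec4_eq_iff)
  then show ?thesis using that[of "c / 2" 0 1] infinity by simp
qed

text \<open>
  \<open>p(x) + y q(x)\<close> is the normal form of \<open>F\<close> modulo \<open>y\<^sup>2 - (x\<^sup>3 - x)\<close>. The degree bounds say that its pole at
  infinity has order at most \<open>4 d\<close>, where \<open>x\<close> has a pole of order \<open>2\<close> and \<open>y\<close> one of order \<open>3\<close>; bounding the
  degree of \<open>x\<^sup>2 q\<close> instead of that of \<open>q\<close> forces \<open>q = 0\<close> for \<open>d = 0\<close>. Continuity of the cofactor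
  \<open>h\<close>, which is a polynomial, is what differentiation along the curve uses.
\<close>

definition restricts_to ::
  "nat \<Rightarrow> (complex \<Rightarrow> complex \<Rightarrow> complex) \<Rightarrow> complex poly \<Rightarrow> complex poly \<Rightarrow> bool" where
  "restricts_to d F p q \<longleftrightarrow> degree p \<le> 2 * d \<and> degree (monom 1 2 * q) \<le> 2 * d \<and>
     (\<exists>h. continuous_on UNIV h \<and>
       (\<forall>x y. F x y = poly p x + y * poly q x + (y\<^sup>2 - (x ^ 3 - x)) * h (x, y)))"

lemma restricts_toI:
  assumes "degree p \<le> 2 * d" "degree (monom 1 2 * q) \<le> 2 * d" "continuous_on UNIV h"
    "\<And>x y. F x y = poly p x + y * poly q x + (y\<^sup>2 - (x ^ 3 - x)) * h (x, y)"
  shows "restricts_to d F p q"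
  using assms unfolding restricts_to_def by blast

lemma restricts_to_add:
  assumes "restricts_to d F p q" "restricts_to d F' p' q'"
  shows "restricts_to d (\<lambda>x y. F x y + F' x y) (p + p') (q + q')"
proof -
  obtain h where h: "continuous_on UNIV h"
    "\<And>x y. F x y = poly p x + y * poly q x + (y\<^sup>2 - (x ^ 3 - x)) * h (x, y)"
    using assms(1) by (auto simp: restricts_to_def)
  obtain h' where h': "continuous_on UNIV h'"
    "\<And>x y. F' x y = poly p' x + y * poly q' x + (y\<^sup>2 - (x ^ 3 - x)) * h' (x, y)"
    using assms(2) by (auto simp: restricts_to_def)
  show ?thesis
  proof (rule restricts_toI[where h = "\<lambda>z. h z + h' z"])
    show "degree (monom 1 2 * (q + q')) \<le> 2 * d"
      using assms unfolding restricts_to_def distrib_left by (auto intro: degree_add_le)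
    show "degree (p + p') \<le> 2 * d"
      using assms by (auto simp: restricts_to_def intro: degree_add_le)
    show "continuous_on UNIV (\<lambda>z. h z + h' z)"
      by (intro continuous_intros h h')
    show "F x y + F' x y = poly (p + p') x + y * poly (q + q') x
        + (y\<^sup>2 - (x ^ 3 - x)) * (h (x, y) + h' (x, y))" for x y
      by (simp add: h(2) h'(2) distrib_left)
  qed
qed

lemma restricts_to_mult:
  assumes "restricts_to d F p q" "restricts_to e F' p' q'"
  shows "restricts_to (d + e) (\<lambda>x y. F x y * F' x y)
           (p * p' + [:0, -1, 0, 1:] * (q * q')) (p * q' + q * p')"
proof -
  obtain h where h: "continuous_on UNIV h"
    "\<And>x y. F x y = poly p x + y * poly q x + (y\<^sup>2 - (x ^ 3 - x)) * h (x, y)"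
    using assms(1) by (auto simp: restricts_to_def)
  obtain h' where h': "continuous_on UNIV h'"
    "\<And>x y. F' x y = poly p' x + y * poly q' x + (y\<^sup>2 - (x ^ 3 - x)) * h' (x, y)"
    using assms(2) by (auto simp: restricts_to_def)
  have deg: "degree p \<le> 2 * d" "degree (monom 1 2 * q) \<le> 2 * d"
    "degree p' \<le> 2 * e" "degree (monom 1 2 * q') \<le> 2 * e"
    using assms by (auto simp: restricts_to_def)
  have dm: "degree (r * s) \<le> 2 * (d + e)" if "degree r \<le> 2 * d" "degree s \<le> 2 * e" for r s :: "complex poly"
    using order_trans[OF degree_mult_le add_mono[OF that]] by simp
  have "degree ([:0, -1, 0, 1:] * (q * q')) \<le> 2 * (d + e)"
  proof (cases "q = 0 \<or> q' = 0")
    case False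
    then have q: "degree (monom 1 2 * q) = 2 + degree q" "degree (monom 1 2 * q') = 2 + degree q'"
      by (simp_all add: degree_mult_eq degree_monom_eq)
    have "degree ([:0, -1, 0, 1:] * (q * q')) = 3 + degree q + degree q'"
      using False by (simp add: degree_mult_eq del: mult_pCons_left)
    also have "\<dots> \<le> 2 * (d + e)" using deg(2,4) unfolding q by presburger
    finally show ?thesis .
  qed auto
  moreover have "monom 1 2 * (p * q' + q * p') = p * (monom 1 2 * q') + (monom 1 2 * q) * p'"
    by (simp add: algebra_simps)
  ultimately have degs: "degree (p * p' + [:0, -1, 0, 1:] * (q * q')) \<le> 2 * (d + e)"
    "degree (monom 1 2 * (p * q' + q * p')) \<le> 2 * (d + e)"
    using dm[OF deg(1,3)] dm[OF deg(1,4)] dm[OF deg(2,3)] by (simp_all only: degree_add_le)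
  show ?thesis
  proof (rule restricts_toI[OF degs, where h = "\<lambda>z. poly q (fst z) * poly q' (fst z)
        + h z * (poly p' (fst z) + snd z * poly q' (fst z)
                 + ((snd z)\<^sup>2 - ((fst z) ^ 3 - fst z)) * h' z)
        + h' z * (poly p (fst z) + snd z * poly q (fst z))"])
    show "continuous_on UNIV (\<lambda>z. poly q (fst z) * poly q' (fst z)
        + h z * (poly p' (fst z) + snd z * poly q' (fst z)
                 + ((snd z)\<^sup>2 - ((fst z) ^ 3 - fst z)) * h' z)
        + h' z * (poly p (fst z) + snd z * poly q (fst z)))"
      by (intro continuous_intros h(1) h'(1))
    have "(P + y * Q + (y\<^sup>2 - C) * H) * (P' + y * Q' + (y\<^sup>2 - C) * H')
        = P * P' + C * (Q * Q') + y * (P * Q' + Q * P') + (y\<^sup>2 - C) *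
          (Q * Q' + H * (P' + y * Q' + (y\<^sup>2 - C) * H') + H' * (P + y * Q))"
      for P P' Q Q' H H' y C :: complex
      by algebra
    moreover have "poly [:0, -1, 0, 1:] x = x ^ 3 - x" for x :: complex
      by (simp add: power3_eq_cube algebra_simps)
    ultimately show "F x y * F' x y = poly (p * p' + [:0, -1, 0, 1:] * (q * q')) x
        + y * poly (p * q' + q * p') x + (y\<^sup>2 - (x ^ 3 - x)) *
        (poly q (fst (x, y)) * poly q' (fst (x, y))
        + h (x, y) * (poly p' (fst (x, y)) + snd (x, y) * poly q' (fst (x, y))
                 + ((snd (x, y))\<^sup>2 - ((fst (x, y)) ^ 3 - fst (x, y))) * h' (x, y))
        + h' (x, y) * (poly p (fst (x, y)) + snd (x, y) * poly q (fst (x, y))))" for x y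
      unfolding h(2) h'(2) poly_add poly_mult fst_conv snd_conv by presburger
  qed
qed

definition restrictable :: "nat \<Rightarrow> (complex \<Rightarrow> complex \<Rightarrow> complex) \<Rightarrow> bool" where
  "restrictable d F \<longleftrightarrow> (\<exists>p q. restricts_to d F p q)"

lemma restrictable_const: "restrictable 0 (\<lambda>x y. c)"
  unfolding restrictable_def
  by (intro exI, rule restricts_toI[of "[:c:]" 0 0 "\<lambda>z. 0"]) auto

lemma restrictable_zero: "restrictable d (\<lambda>x y. 0)"
  unfolding restrictable_def
  by (intro exI, rule restricts_toI[of 0 d 0 "\<lambda>z. 0"]) auto

lemma restrictable_mult:
  "restrictable d F \<Longrightarrow> restrictable e G \<Longrightarrow> restrictable (d + e) (\<lambda>x y. F x y * G x y)"
  unfolding restrictable_def using restricts_to_mult by blast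

lemma restrictable_add:
  "restrictable d F \<Longrightarrow> restrictable d G \<Longrightarrow> restrictable d (\<lambda>x y. F x y + G x y)"
  unfolding restrictable_def using restricts_to_add by blast

lemma restrictable_sum:
  "(\<And>i. i \<in> I \<Longrightarrow> restrictable d (F i)) \<Longrightarrow> restrictable d (\<lambda>x y. \<Sum>i\<in>I. F i x y)"
  by (induction I rule: infinite_finite_induct) (auto intro: restrictable_add restrictable_zero)

lemma restrictable_power: "restrictable d F \<Longrightarrow> restrictable (n * d) (\<lambda>x y. F x y ^ n)"
  by (induction n) (auto intro: restrictable_mult restrictable_const)

lemma restrictable_prod:
  "finite I \<Longrightarrow> (\<And>i. i \<in> I \<Longrightarrow> restrictable (d i) (F i)) \<Longrightarrow>
     restrictable (\<Sum>i\<in>I. d i) (\<lambda>x y. \<Prod>i\<in>I. F i x y)"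
  by (induction I rule: finite_induct) (auto intro: restrictable_mult restrictable_const)

lemma restrictable_coordinate: "restrictable 1 (\<lambda>x y. (V *v affine_vec x y) $ i)"
  unfolding restrictable_def
proof (intro exI, rule restricts_toI[where h = "\<lambda>z. 0"])
  show "(V *v affine_vec x y) $ i = poly [:V $ i $ 1, V $ i $ 2, V $ i $ 4:] x
      + y * poly [:V $ i $ 3:] x + (y\<^sup>2 - (x ^ 3 - x)) * 0" for x y
    by (simp add: matrix_vector_mult_def sum_4 affine_vec_def algebra_simps power2_eq_square)
  show "degree (monom 1 2 * [:V $ i $ 3:]) \<le> 2 * 1"
    using degree_monom_le[of "V $ i $ 3" 2] by (simp add: smult_monom)
qed auto

text \<open>
  A coordinate of the embedded curve is a combination of \<open>1\<close>, \<open>x\<close>, \<open>y\<close>, \<open>x\<^sup>2\<close>, and the normal forms are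
  closed under sums and products.
\<close>

lemma form_restrictable:
  assumes "homogeneous d f"
  shows "restrictable d (\<lambda>x y. peval f (V *v affine_vec x y))"
  unfolding peval_def
proof (rule restrictable_sum)
  fix m assume m: "m \<in> Poly_Mapping.keys f"
  have "restrictable (\<Sum>i\<in>UNIV. Poly_Mapping.lookup m i * 1)
     (\<lambda>x y. \<Prod>i\<in>UNIV. (V *v affine_vec x y) $ i ^ Poly_Mapping.lookup m i)"
    by (intro restrictable_prod restrictable_power restrictable_coordinate) auto
  with m assms have "restrictable d
     (\<lambda>x y. \<Prod>i\<in>UNIV. (V *v affine_vec x y) $ i ^ Poly_Mapping.lookup m i)"
    by (simp add: homogeneous_def)
  from restrictable_mult[OF restrictable_const this]
  show "restrictable d (\<lambda>x y. Poly_Mapping.lookup f m *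
      (\<Prod>i\<in>UNIV. (V *v affine_vec x y) $ i ^ Poly_Mapping.lookup m i))" by simp
qed

abbreviation cubic :: "(complex \<times> complex) set" where
  "cubic \<equiv> {(x, y). y\<^sup>2 = x ^ 3 - x}"

lemma finite_square_roots: "finite {y :: complex. y\<^sup>2 = c}"
proof -
  have "{y :: complex. y\<^sup>2 = c} = {y. poly [:-c, 0, 1:] y = 0}"
    by (auto simp: power2_eq_square)
  also have "finite \<dots>" by (rule poly_roots_finite) simp
  finally show ?thesis .
qed

lemma infinite_cubic: "infinite cubic"
proof
  assume "finite cubic"
  then have fin: "finite (fst ` cubic)" by (rule finite_imageI)
  have "x \<in> fst ` cubic" for x
    by (rule image_eqI[of _ _ "(x, csqrt (x ^ 3 - x))"]) simp_all
  then have "fst ` cubic = UNIV" by blast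
  with fin show False by (simp only: infinite_UNIV_char_0)
qed

text \<open>
  The norm \<open>p\<^sup>2 - (x\<^sup>3 - x) q\<^sup>2\<close> vanishes at the abscissa of every zero, so it is the zero polynomial; then
  \<open>p\<^sup>2 = (x\<^sup>3 - x) q\<^sup>2\<close>, where the degrees of the two sides have different parity unless both vanish.
\<close>

lemma cubic_zeros_infinite_imp_zero:
  assumes "infinite {(x, y) \<in> cubic. poly p x + y * poly q x = 0}"
  shows "p = 0 \<and> q = 0"
proof -
  let ?N = "p\<^sup>2 - [:0, -1, 0, 1:] * q\<^sup>2"
  have N0: "?N = 0"
  proof (rule ccontr)
    assume "?N \<noteq> 0"
    then have "finite {x. poly ?N x = 0}" by (rule poly_roots_finite)
    then have "finite (Sigma {x. poly ?N x = 0} (\<lambda>x. {y. y\<^sup>2 = x ^ 3 - x}))"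
      by (intro finite_SigmaI finite_square_roots)
    moreover have "{(x, y) \<in> cubic. poly p x + y * poly q x = 0}
        \<subseteq> Sigma {x. poly ?N x = 0} (\<lambda>x. {y. y\<^sup>2 = x ^ 3 - x})"
    proof
      fix z assume "z \<in> {(x, y) \<in> cubic. poly p x + y * poly q x = 0}"
      then obtain x y where z: "z = (x, y)" "y\<^sup>2 = x ^ 3 - x" "poly p x + y * poly q x = 0"
        by blast
      from z(3) have "poly p x = - (y * poly q x)"
        by (simp add: eq_neg_iff_add_eq_0)
      then have "(poly p x)\<^sup>2 = (x ^ 3 - x) * (poly q x)\<^sup>2"
        by (simp add: power_mult_distrib z(2))
      then have "poly ?N x = 0"
        by (simp add: power3_eq_cube algebra_simps)
      with z show "z \<in> Sigma {x. poly ?N x = 0} (\<lambda>x. {y. y\<^sup>2 = x ^ 3 - x})" by blast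
    qed
    ultimately show False
      using assms finite_subset by blast
  qed
  have "q = 0"
  proof (rule ccontr)
    assume "q \<noteq> 0"
    have eq: "p\<^sup>2 = [:0, -1, 0, 1:] * q\<^sup>2" using N0 by simp
    with \<open>q \<noteq> 0\<close> have "p \<noteq> 0" by (auto simp del: mult_pCons_left)
    have "degree (p\<^sup>2) = 3 + 2 * degree q"
      unfolding eq using \<open>q \<noteq> 0\<close> by (simp add: degree_mult_eq degree_power_eq del: mult_pCons_left)
    then have "2 * degree p = 3 + 2 * degree q" using \<open>p \<noteq> 0\<close> by (simp add: degree_power_eq)
    then show False by presburger
  qed
  with N0 show ?thesis by simp
qed

lemma restriction_unique_zero:
  assumes "restricts_to d F p q" "infinite {(x, y) \<in> cubic. F x y = 0}"
  shows "p = 0 \<and> q = 0"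
proof -
  have "{(x, y) \<in> cubic. F x y = 0} = {(x, y) \<in> cubic. poly p x + y * poly q x = 0}"
    using assms(1) by (auto simp: restricts_to_def)
  with assms(2) show ?thesis using cubic_zeros_infinite_imp_zero[of p q] by simp
qed

section \<open>Linear embeddings of the quartic: irreducibility and smoothness\<close>

definition coordinate_form :: "complex ^ 'v::finite ^ 'n \<Rightarrow> 'n \<Rightarrow> 'v cpoly" where
  "coordinate_form W k = (\<Sum>i\<in>UNIV. cscale (W $ k $ i) (Var i))"

lemma peval_coordinate_form [simp]: "peval (coordinate_form W k) x = (W *v x) $ k"
  by (simp add: coordinate_form_def matrix_vector_mult_def)

lemma homogeneous_coordinate_form: "homogeneous 1 (coordinate_form W k)"
  unfolding coordinate_form_def by (intro homogeneous_sum homogeneous_cscale homogeneous_Var)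

lemma (in complex_subring) coeffs_in_coordinate_form:
  "(\<And>i. W $ k $ i \<in> K) \<Longrightarrow> coeffs_in K (coordinate_form W k)"
  unfolding coordinate_form_def by (intro coeffs_in_sum coeffs_in_cscale coeffs_in_Var)

text \<open>
  Equations of the image of the quartic under \<open>V\<close>, where \<open>W\<close> is a left inverse of \<open>V\<close>: the last family says
  that a vector \<open>x\<close> lies in the image \<open>{x. x = V (W x)}\<close> of \<open>V\<close>, the two quadrics that its preimage \<open>W x\<close> lies
  on the quartic.
\<close>

definition quartic_equations :: "complex ^ 4 ^ 'v \<Rightarrow> complex ^ 'v::finite ^ 4 \<Rightarrow> 'v cpoly set" where
  "quartic_equations V W =
     {coordinate_form W 1 * coordinate_form W 4 - (coordinate_form W 2)\<^sup>2,
      (coordinate_form W 3)\<^sup>2 - coordinate_form W 2 * (coordinate_form W 4 - coordinate_form W 1)}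
     \<union> range (\<lambda>i. Var i - coordinate_form (V ** W) i)"

lemma quartic_equations_homogeneous:
  assumes "f \<in> quartic_equations V W" shows "\<exists>d. homogeneous d f"
proof -
  have "homogeneous (1 + 1) (coordinate_form W 1 * coordinate_form W 4 - (coordinate_form W 2)\<^sup>2)"
       "homogeneous (1 + 1) ((coordinate_form W 3)\<^sup>2
          - coordinate_form W 2 * (coordinate_form W 4 - coordinate_form W 1))"
    unfolding power2_eq_square
    by (intro homogeneous_diff homogeneous_mult homogeneous_coordinate_form)+
  moreover have "homogeneous 1 (Var i - coordinate_form (V ** W) i)" for i
    by (intro homogeneous_diff homogeneous_Var homogeneous_coordinate_form)
  ultimately show ?thesis using assms unfolding quartic_equations_def by blast
qed

locale quartic_model =
  fixes V :: "complex ^ 4 ^ 'v::finite" and W :: "complex ^ 'v ^ 4"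
  assumes left_inverse: "W ** V = mat 1"
begin

lemma coordinates [simp]: "W *v (V *v u) = u"
  by (simp add: matrix_vector_mul_assoc left_inverse)

lemma embedding_eq_iff: "V *v u = V *v v \<longleftrightarrow> u = v"
  by (metis coordinates)

lemma embedding_eq_0_iff [simp]: "V *v u = 0 \<longleftrightarrow> u = 0"
  using embedding_eq_iff[of u 0] by simp

lemma embedding_smult: "V *v (c *s u) = c *s (V *v u)"
  by (simp add: vector_scalar_commute)

lemma quartic_model_reflection: "quartic_model (V ** reflection) (reflection ** W)"
proof
  have "(reflection ** W) ** (V ** reflection) = reflection ** (W ** V) ** reflection"
    by (simp add: matrix_mul_assoc)
  then show "reflection ** W ** (V ** reflection) = mat 1"
    by (simp add: left_inverse reflection_squared)
qed

lemma quartic_curve_subset: "quartic_curve V \<subseteq> proj_space"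
  by (auto simp: quartic_curve_def)

lemma quartic_curveE:
  assumes "P \<in> quartic_curve V" "x \<in> P"
  obtains u where "u \<in> quartic_cone" "u \<noteq> 0" "x = V *v u"
proof -
  obtain u c where "u \<in> quartic_cone" "u \<noteq> 0" "c \<noteq> 0" "x = c *s (V *v u)"
    using assms by (auto simp: quartic_curve_def proj_point_def)
  then show ?thesis
    using that[of "c *s u"] by (simp add: embedding_smult smult_quartic_cone)
qed

lemma proj_point_in_quartic_curve:
  "u \<in> quartic_cone \<Longrightarrow> u \<noteq> 0 \<Longrightarrow> proj_point (V *v u) \<in> quartic_curve V"
  by (auto simp: quartic_curve_def)

lemma quartic_equations_zero_iff:
  "(\<forall>f\<in>quartic_equations V W. peval f x = 0) \<longleftrightarrow> (\<exists>u\<in>quartic_cone. x = V *v u)"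
proof -
  have "(\<forall>f\<in>quartic_equations V W. peval f x = 0) \<longleftrightarrow> W *v x \<in> quartic_cone \<and> x = V *v (W *v x)"
    by (simp add: quartic_equations_def quartic_cone_def vec_eq_iff[of x]
        matrix_vector_mul_assoc ball_Un)
  also have "\<dots> \<longleftrightarrow> (\<exists>u\<in>quartic_cone. x = V *v u)" by auto
  finally show ?thesis .
qed

lemma quartic_curve_eq_proj_zeros: "quartic_curve V = proj_zeros (quartic_equations V W)"
proof -
  have iff: "proj_point x \<in> proj_zeros (quartic_equations V W)
      \<longleftrightarrow> x \<noteq> 0 \<and> (\<exists>u\<in>quartic_cone. x = V *v u)" for x
    by (simp only: proj_point_in_proj_zeros[OF quartic_equations_homogeneous]
        quartic_equations_zero_iff)
  show ?thesis
  proof (intro equalityI subsetI)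
    fix P assume "P \<in> quartic_curve V"
    then obtain u where u: "u \<in> quartic_cone" "u \<noteq> 0" "P = proj_point (V *v u)"
      by (auto simp: quartic_curve_def)
    then have "V *v u \<noteq> 0" by simp
    with u(1) show "P \<in> proj_zeros (quartic_equations V W)" unfolding u(3) iff by blast
  next
    fix P assume P: "P \<in> proj_zeros (quartic_equations V W)"
    then have "P \<in> proj_space" by (simp add: proj_zeros_def)
    then obtain x where x: "P = proj_point x" by (rule proj_spaceE)
    with P iff obtain u where u: "u \<in> quartic_cone" "x = V *v u" "x \<noteq> 0" by auto
    then have "u \<noteq> 0" by auto
    with u show "P \<in> quartic_curve V" unfolding x by (simp add: proj_point_in_quartic_curve)
  qed
qed

lemma quartic_equations_vanish:
  assumes "f \<in> quartic_equations V W" obtains d where "f \<in> vanishing_forms (quartic_curve V) d"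
proof -
  obtain d where "homogeneous d f" using quartic_equations_homogeneous[OF assms] by blast
  moreover have "\<forall>P\<in>quartic_curve V. \<forall>x\<in>P. peval f x = 0"
    using assms by (simp add: quartic_curve_eq_proj_zeros proj_zeros_def)
  ultimately show ?thesis using that by (simp add: vanishing_forms_def forms_def)
qed

lemma infinite_quartic_curve: "infinite (quartic_curve V)"
proof
  assume fin: "finite (quartic_curve V)"
  have "inj_on (\<lambda>z. proj_point (V *v affine_vec (fst z) (snd z))) cubic"
  proof (rule inj_onI)
    fix z z' :: "complex \<times> complex"
    assume "proj_point (V *v affine_vec (fst z) (snd z)) = proj_point (V *v affine_vec (fst z') (snd z'))"
    then have "V *v affine_vec (fst z) (snd z) \<in> proj_point (V *v affine_vec (fst z') (snd z'))"
      using proj_point_self[of "V *v affine_vec (fst z) (snd z)"] by simp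
    then obtain c where "V *v affine_vec (fst z) (snd z) = V *v (c *s affine_vec (fst z') (snd z'))"
      by (auto simp: proj_point_def embedding_smult)
    then have "affine_vec (fst z) (snd z) = c *s affine_vec (fst z') (snd z')"
      by (simp only: embedding_eq_iff)
    then show "z = z'" by (simp add: affine_vec_def vec4_eq_iff prod_eq_iff)
  qed
  moreover have "(\<lambda>z. proj_point (V *v affine_vec (fst z) (snd z))) ` cubic \<subseteq> quartic_curve V"
    by (auto intro!: proj_point_in_quartic_curve affine_vec_in_cone)
  ultimately have "finite cubic" using fin inj_on_finite by blast
  then show False using infinite_cubic by simp
qed

lemma form_vanishes_on_affine_part:
  assumes "homogeneous d f" "infinite {P \<in> quartic_curve V. \<forall>x\<in>P. peval f x = 0}" "y\<^sup>2 = x ^ 3 - x"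
  shows "peval f (V *v affine_vec x y) = 0"
proof -
  let ?Z = "{(x, y) \<in> cubic. peval f (V *v affine_vec x y) = 0}"
  let ?pt = "\<lambda>z. proj_point (V *v affine_vec (fst z) (snd z))"
  have "{P \<in> quartic_curve V. \<forall>x\<in>P. peval f x = 0} \<subseteq> insert (proj_point (V *v vec4 0 0 0 1)) (?pt ` ?Z)"
  proof
    fix P assume P: "P \<in> {P \<in> quartic_curve V. \<forall>x\<in>P. peval f x = 0}"
    then obtain u where u: "u \<in> quartic_cone" "u \<noteq> 0" "P = proj_point (V *v u)"
      by (auto simp: quartic_curve_def)
    from u(1,2) show "P \<in> insert (proj_point (V *v vec4 0 0 0 1)) (?pt ` ?Z)"
    proof (cases rule: quartic_cone_cases)
      case (affine c x y)
      then have eq: "P = ?pt (x, y)" using u(3) by (simp add: embedding_smult proj_point_smult)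
      have "V *v affine_vec x y \<in> P" unfolding eq by simp
      with P affine have "(x, y) \<in> ?Z" by blast
      with eq show ?thesis by blast
    next
      case (infinity c)
      then show ?thesis using u(3) by (simp add: embedding_smult proj_point_smult)
    qed
  qed
  with assms(2) have "infinite ?Z" by (meson finite_imageI finite_insert finite_subset)
  moreover obtain p q where pq: "restricts_to d (\<lambda>x y. peval f (V *v affine_vec x y)) p q"
    using form_restrictable[OF assms(1), of V] by (auto simp: restrictable_def)
  ultimately have "p = 0 \<and> q = 0" using restriction_unique_zero by blast
  with pq show ?thesis using assms(3) by (auto simp: restricts_to_def)
qed

text \<open>
  A point at infinity is written as an affine point for the matrix \<open>V\<close> composed with the reflection, which
  has the same image curve.
\<close>

lemma affine_cover:
  assumes "P \<in> quartic_curve V" "x \<in> P"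
  obtains c a b V' W' where "c \<noteq> 0" "b\<^sup>2 = a ^ 3 - a" "x = c *s (V' *v affine_vec a b)"
    "quartic_model V' W'" "quartic_curve V' = quartic_curve V"
proof -
  obtain u where u: "u \<in> quartic_cone" "u \<noteq> 0" "x = V *v u" using assms by (rule quartic_curveE)
  obtain c a b where *: "c \<noteq> 0" "b\<^sup>2 = a ^ 3 - a"
     "u = c *s affine_vec a b \<or> u = c *s (reflection *v affine_vec a b)"
    using u(1,2) by (rule quartic_cone_affine_cover)
  from *(3) show ?thesis
  proof
    assume "u = c *s affine_vec a b"
    then show ?thesis using that[of c b a V W] * u quartic_model_axioms by (simp add: embedding_smult)
  next
    assume "u = c *s (reflection *v affine_vec a b)"
    then have "x = c *s ((V ** reflection) *v affine_vec a b)"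
      using u(3) by (simp add: embedding_smult flip: matrix_vector_mul_assoc)
    then show ?thesis
      using that * quartic_model_reflection quartic_curve_reflection by blast
  qed
qed

text \<open>
  Finiteness of zero sets in contrapositive form. Infinitely many zeros force vanishing on the affine
  part of each of the two parametrisations, and these cover the curve.
\<close>

lemma form_vanishes:
  assumes "homogeneous d f" "infinite {P \<in> quartic_curve V. \<forall>x\<in>P. peval f x = 0}"
    "P \<in> quartic_curve V" "x \<in> P"
  shows "peval f x = 0"
proof -
  obtain c a b V' W' where *: "c \<noteq> 0" "b\<^sup>2 = a ^ 3 - a" "x = c *s (V' *v affine_vec a b)"
    "quartic_model V' W'" "quartic_curve V' = quartic_curve V"
    using assms(3,4) by (rule affine_cover)
  have "peval f (V' *v affine_vec a b) = 0"
    by (rule quartic_model.form_vanishes_on_affine_part[OF *(4) assms(1) _ *(2)])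
      (use assms(2) *(5) in simp)
  then show ?thesis using peval_scale[OF assms(1)] *(3) by simp
qed

sublocale cofinite_curve "quartic_curve V"
proof
  show "infinite (quartic_curve V)" by (rule infinite_quartic_curve)
  show "proj_closed (quartic_curve V)"
    unfolding proj_closed_over_def quartic_curve_eq_proj_zeros coeffs_in_def
    using quartic_equations_homogeneous by (intro exI[of _ "quartic_equations V W"]) blast
  show "finite {P \<in> quartic_curve V. \<forall>x\<in>P. peval f x = 0}"
    if "homogeneous d f" "\<exists>P\<in>quartic_curve V. \<exists>x\<in>P. peval f x \<noteq> 0" for d f
    using form_vanishes[OF that(1)] that(2) by blast
qed

text \<open>
  The restriction sees the affine part only; a form vanishing there has infinitely many zeros on the
  curve and so vanishes at infinity as well.
\<close>

lemma vanishing_form_iff_restriction_zero: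
  assumes "homogeneous d f" "restricts_to d (\<lambda>x y. peval f (V *v affine_vec x y)) p q"
  shows "f \<in> vanishing_forms (quartic_curve V) d \<longleftrightarrow> p = 0 \<and> q = 0"
proof
  assume "f \<in> vanishing_forms (quartic_curve V) d"
  then have "{P \<in> quartic_curve V. \<forall>x\<in>P. peval f x = 0} = quartic_curve V"
    by (auto simp: vanishing_forms_def)
  then have "peval f (V *v affine_vec x y) = 0" if "y\<^sup>2 = x ^ 3 - x" for x y
    using form_vanishes_on_affine_part[OF assms(1) _ that] infinite_quartic_curve by simp
  then have "{(x, y) \<in> cubic. peval f (V *v affine_vec x y) = 0} = cubic" by auto
  then show "p = 0 \<and> q = 0" using restriction_unique_zero[OF assms(2)] infinite_cubic by simp
next
  assume "p = 0 \<and> q = 0"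
  then have zero: "peval f (V *v affine_vec x y) = 0" if "y\<^sup>2 = x ^ 3 - x" for x y
    using assms(2) that by (auto simp: restricts_to_def)
  have "quartic_curve V \<subseteq> insert (proj_point (V *v vec4 0 0 0 1))
      {P \<in> quartic_curve V. \<forall>x\<in>P. peval f x = 0}"
  proof
    fix P assume P: "P \<in> quartic_curve V"
    then obtain u where u: "u \<in> quartic_cone" "u \<noteq> 0" "P = proj_point (V *v u)"
      by (auto simp: quartic_curve_def)
    from u(1,2) show "P \<in> insert (proj_point (V *v vec4 0 0 0 1))
        {P \<in> quartic_curve V. \<forall>x\<in>P. peval f x = 0}"
    proof (cases rule: quartic_cone_cases)
      case (affine c x y)
      have "\<forall>x\<in>P. peval f x = 0"
        unfolding u(3) form_vanishes_at_proj_point[OF assms(1)] affine(3) embedding_smult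
          peval_scale[OF assms(1)] zero[OF affine(2)] by simp
      with P show ?thesis by blast
    next
      case (infinity c)
      then show ?thesis using u(3) by (simp add: embedding_smult proj_point_smult)
    qed
  qed
  then have "infinite {P \<in> quartic_curve V. \<forall>x\<in>P. peval f x = 0}"
    using infinite_quartic_curve by (meson finite_insert finite_subset)
  then have "peval f x = 0" if "P \<in> quartic_curve V" "x \<in> P" for P x
    using form_vanishes[OF assms(1) _ that] by simp
  then show "f \<in> vanishing_forms (quartic_curve V) d"
    using assms(1) by (simp add: vanishing_forms_def forms_def)
qed

text \<open>
  The vector \<open>(2 b, 3 a\<^sup>2 - 1)\<close> is tangent to the cubic at \<open>(a, b)\<close>; its image under the embedding is the
  vector below. As a function of \<open>x\<close> and \<open>y\<close> the form \<open>f\<close> is a multiple of \<open>y\<^sup>2 - (x\<^sup>3 - x)\<close>, which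
  vanishes to second order at \<open>(a, b)\<close> along the tangent line, so \<open>f\<close> has derivative zero along it.
\<close>

lemma gradient_along_curve:
  assumes "f \<in> vanishing_forms (quartic_curve V) d" "b\<^sup>2 = a ^ 3 - a" "c \<noteq> 0"
  shows "(\<Sum>i\<in>UNIV. peval (partial i f) (c *s (V *v affine_vec a b))
           * (V *v vec4 0 (2 * b) (3 * a\<^sup>2 - 1) (4 * a * b)) $ i) = 0"
proof -
  let ?\<gamma> = "\<lambda>t. c *s (V *v affine_vec (a + t * (2 * b)) (b + t * (3 * a\<^sup>2 - 1)))"
  let ?v = "c *s (V *v vec4 0 (2 * b) (3 * a\<^sup>2 - 1) (4 * a * b))"
  have f: "homogeneous d f"
    using assms(1) by (simp add: vanishing_forms_def forms_def)
  have "((\<lambda>t. ?\<gamma> t $ i) has_field_derivative ?v $ i) (at 0)" for i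
    by (auto simp: matrix_vector_mult_def sum_4 affine_vec_def algebra_simps power2_eq_square
        intro!: derivative_eq_intros)
  from peval_has_field_derivative[OF this, of f]
  have D: "((\<lambda>t. peval f (?\<gamma> t)) has_field_derivative
      (\<Sum>i\<in>UNIV. peval (partial i f) (?\<gamma> 0) * ?v $ i)) (at 0)" .
  obtain p q where pq: "restricts_to d (\<lambda>x y. peval f (V *v affine_vec x y)) p q"
    using form_restrictable[OF f, of V] by (auto simp: restrictable_def)
  have "p = 0 \<and> q = 0"
    using vanishing_form_iff_restriction_zero[OF f pq] assms(1) by blast
  then obtain h where h: "continuous_on UNIV h"
    "\<And>x y. peval f (V *v affine_vec x y) = (y\<^sup>2 - (x ^ 3 - x)) * h (x, y)"
    using pq by (auto simp: restricts_to_def)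
  let ?e = "\<lambda>t. (b + t * (3 * a\<^sup>2 - 1))\<^sup>2 - ((a + t * (2 * b)) ^ 3 - (a + t * (2 * b)))"
  let ?h = "\<lambda>t. h (a + t * (2 * b), b + t * (3 * a\<^sup>2 - 1))"
  let ?r = "\<lambda>t. (3 * a\<^sup>2 - 1)\<^sup>2 - 12 * a * b\<^sup>2 - 8 * b ^ 3 * t"
  \<comment> \<open>The Taylor expansion of \<open>y\<^sup>2 - (x\<^sup>3 - x)\<close> on the tangent line starts in degree two.\<close>
  have e: "?e t = t\<^sup>2 * ?r t" for t
    using assms(2) by algebra
  have eq: "peval f (?\<gamma> t) = t * (c ^ d * t * ?r t * ?h t)" for t
    unfolding peval_scale[OF f] h(2) e by (simp add: power2_eq_square)
  have "continuous_on UNIV (\<lambda>t. c ^ d * t * ?r t * ?h t)"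
    by (intro continuous_intros continuous_on_compose2[OF h(1)]) auto
  then have "isCont (\<lambda>t. c ^ d * t * ?r t * ?h t) 0"
    by (simp add: continuous_on_eq_continuous_at)
  then have "((\<lambda>t. peval f (?\<gamma> t)) has_field_derivative 0) (at 0)"
    unfolding eq CARAT_DERIV by (intro exI[of _ "\<lambda>t. c ^ d * t * ?r t * ?h t"]) simp
  from DERIV_unique[OF D this] have "c * (\<Sum>i\<in>UNIV. peval (partial i f) (c *s (V *v affine_vec a b))
      * (V *v vec4 0 (2 * b) (3 * a\<^sup>2 - 1) (4 * a * b)) $ i) = 0"
    by (simp add: sum_distrib_left mult_ac)
  with assms(3) show ?thesis by simp
qed

end

lemma vanishing_form_directional:
  assumes "v \<in> cone_tangent X x" "f \<in> vanishing_forms X d"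
    "((\<lambda>t. peval f (x + t *s v)) has_field_derivative D) (at 0)"
  shows "D = 0"
proof -
  have "((\<lambda>t. (x + t *s v) $ i) has_field_derivative v $ i) (at 0)" for i
    by (auto intro!: derivative_eq_intros)
  from peval_has_field_derivative[OF this, of f]
  have "((\<lambda>t. peval f (x + t *s v)) has_field_derivative
      (\<Sum>i\<in>UNIV. peval (partial i f) x * v $ i)) (at 0)" by simp
  moreover have "(\<Sum>i\<in>UNIV. peval (partial i f) x * v $ i) = 0"
    using assms(1,2) by (auto simp: cone_tangent_def)
  ultimately show ?thesis using assms(3) DERIV_unique by metis
qed

lemma subspace_cone_tangent: "vec.subspace (cone_tangent X x)"
  unfolding vec.subspace_def cone_tangent_def
  by (auto simp: distrib_left sum.distrib mult.left_commute simp flip: sum_distrib_left)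

text \<open>
  Euler's relation: along the ray through \<open>x\<close> a vanishing form is constantly zero.
\<close>

lemma (in quartic_model) point_in_cone_tangent:
  assumes "P \<in> quartic_curve V" "x \<in> P" shows "x \<in> cone_tangent (quartic_curve V) x"
  unfolding cone_tangent_def
proof (intro CollectI allI ballI)
  fix d f assume f: "f \<in> vanishing_forms (quartic_curve V) d"
  have "((\<lambda>t. (x + t *s x) $ i) has_field_derivative x $ i) (at 0)" for i
    by (auto intro!: derivative_eq_intros)
  from peval_has_field_derivative[OF this, of f]
  have D: "((\<lambda>t. peval f (x + t *s x)) has_field_derivative
      (\<Sum>i\<in>UNIV. peval (partial i f) x * x $ i)) (at 0)" by simp
  have "peval f (x + t *s x) = 0" for t
  proof -
    have "x + t *s x = (1 + t) *s x" by (simp add: vec_eq_iff distrib_right)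
    moreover have "homogeneous d f" "peval f x = 0"
      using f assms by (auto simp: vanishing_forms_def forms_def)
    ultimately show ?thesis by (simp only: peval_scale mult_zero_right)
  qed
  then have "((\<lambda>t. peval f (x + t *s x)) has_field_derivative 0) (at 0)" by simp
  with D show "(\<Sum>i\<in>UNIV. peval (partial i f) x * x $ i) = 0" by (rule DERIV_unique)
qed


context quartic_model
begin

text \<open>
  The two vectors lie in the tangent space by Euler's relation and by \<open>gradient_along_curve\<close>. Conversely
  the equations of the curve already bound the tangent space: modulo the position vector the two
  quadrics leave \<open>2 b u\<^sub>3 = (3 a\<^sup>2 - 1) u\<^sub>2\<close>, and \<open>2 b\<close> and \<open>3 a\<^sup>2 - 1\<close> have no common zero on the cubic.
\<close>

lemma cone_tangent_affine:
  assumes "b\<^sup>2 = a ^ 3 - a" "c \<noteq> 0"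
  shows "cone_tangent (quartic_curve V) (c *s (V *v affine_vec a b)) =
    vec.span {V *v affine_vec a b, V *v vec4 0 (2 * b) (3 * a\<^sup>2 - 1) (4 * a * b)}"
    (is "cone_tangent ?X ?x = vec.span {?w, ?t}")
proof (intro equalityI vec.span_minimal subspace_cone_tangent)
  have P: "proj_point ?w \<in> ?X"
    by (intro proj_point_in_quartic_curve affine_vec_in_cone assms affine_vec_nonzero)
  have "?x \<in> proj_point ?w" using assms(2) by (auto simp: proj_point_def)
  then have "?x \<in> cone_tangent ?X ?x" by (rule point_in_cone_tangent[OF P])
  then have "inverse c *s ?x \<in> cone_tangent ?X ?x"
    by (rule vec.subspace_scale[OF subspace_cone_tangent])
  moreover have "inverse c *s ?x = ?w" using assms(2) by (simp add: vec_eq_iff)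
  ultimately have "?w \<in> cone_tangent ?X ?x" by (simp only:)
  moreover have "?t \<in> cone_tangent ?X ?x"
    unfolding cone_tangent_def using gradient_along_curve[OF _ assms] by blast
  ultimately show "{?w, ?t} \<subseteq> cone_tangent ?X ?x" by blast
  show "cone_tangent ?X ?x \<subseteq> vec.span {?w, ?t}"
  proof
    fix v assume v: "v \<in> cone_tangent ?X ?x"
    define u where "u = W *v v"
    have D0: "D = 0" if "f \<in> quartic_equations V W"
        "((\<lambda>t. peval f (?x + t *s v)) has_field_derivative D) (at 0)" for f D
      using quartic_equations_vanish[OF that(1)] vanishing_form_directional[OF v _ that(2)] by metis
    have W: "(W *v (?x + t *s v)) $ k = c * affine_vec a b $ k + t * u $ k" for t k
      by (simp add: matrix_vector_right_distrib vector_scalar_commute u_def)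
    have lin: "v = V *v u"
    proof (rule vec_eq_iff[THEN iffD2], rule allI)
      fix i
      have VW: "(V ** W) *v ?x = ?x"
        by (simp add: vector_scalar_commute flip: matrix_vector_mul_assoc)
      have "peval (Var i - coordinate_form (V ** W) i) (?x + t *s v)
          = t * (v $ i - (V *v u) $ i)" for t
        by (simp add: matrix_vector_right_distrib VW)
           (simp add: u_def vector_scalar_commute matrix_vector_mul_assoc algebra_simps)
      then have "((\<lambda>t. peval (Var i - coordinate_form (V ** W) i) (?x + t *s v))
          has_field_derivative (v $ i - (V *v u) $ i)) (at 0)"
        by (auto intro!: derivative_eq_intros)
      from D0[OF _ this] show "v $ i = (V *v u) $ i" by (simp add: quartic_equations_def)
    qed
    let ?f1 = "coordinate_form W 1 * coordinate_form W 4 - (coordinate_form W 2)\<^sup>2"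
    let ?f2 = "(coordinate_form W 3)\<^sup>2 - coordinate_form W 2 * (coordinate_form W 4 - coordinate_form W 1)"
    have "((\<lambda>t. peval ?f1 (?x + t *s v)) has_field_derivative
        (c * (a\<^sup>2 * u $ 1 + u $ 4 - 2 * a * u $ 2))) (at 0)"
      unfolding peval_diff peval_mult peval_power peval_coordinate_form W
      unfolding affine_vec_def vec4_nth
      by (auto simp: algebra_simps power2_eq_square intro!: derivative_eq_intros)
    from D0[OF _ this] have "a\<^sup>2 * u $ 1 + u $ 4 - 2 * a * u $ 2 = 0"
      using assms(2) by (simp add: quartic_equations_def)
    then have 1: "u $ 4 = 2 * a * u $ 2 - a\<^sup>2 * u $ 1" by (simp add: algebra_simps)
    have "((\<lambda>t. peval ?f2 (?x + t *s v)) has_field_derivative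
        (c * (2 * b * u $ 3 - (u $ 2 * (a\<^sup>2 - 1) + a * (u $ 4 - u $ 1))))) (at 0)"
      unfolding peval_diff peval_mult peval_power peval_coordinate_form W
      unfolding affine_vec_def vec4_nth
      by (auto simp: algebra_simps power2_eq_square intro!: derivative_eq_intros)
    from D0[OF _ this] have 2: "2 * b * u $ 3 = u $ 2 * (a\<^sup>2 - 1) + a * (u $ 4 - u $ 1)"
      using assms(2) by (simp add: quartic_equations_def)
    define u2 u3 where "u2 = u $ 2 - a * u $ 1" and "u3 = u $ 3 - b * u $ 1"
    have u23: "2 * b * u3 = (3 * a\<^sup>2 - 1) * u2"
      using 1 2 assms(1) unfolding u2_def u3_def by algebra
    obtain l where l: "u2 = l * (2 * b)" "u3 = l * (3 * a\<^sup>2 - 1)"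
    proof (cases "b = 0")
      case False
      then show ?thesis using that[of "u2 / (2 * b)"] u23 by (simp add: field_simps)
    next
      case True
      have "3 * a\<^sup>2 - 1 \<noteq> 0"
      proof
        assume "3 * a\<^sup>2 - 1 = 0"
        moreover have "a ^ 3 - a = 0" using assms(1) True by simp
        ultimately have "(1::complex) = 0" by algebra
        then show False by simp
      qed
      then show ?thesis using that[of "u3 / (3 * a\<^sup>2 - 1)"] u23 True by simp
    qed
    have "u = (u $ 1) *s affine_vec a b + l *s vec4 0 (2 * b) (3 * a\<^sup>2 - 1) (4 * a * b)"
      using l 1 unfolding u2_def u3_def by (simp add: vec4_eq_iff affine_vec_def) algebra
    then have "v = (u $ 1) *s ?w + l *s ?t"
      unfolding lin by (metis matrix_vector_right_distrib embedding_smult)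
    then show "v \<in> vec.span {?w, ?t}"
      by (simp only:) (intro vec.span_add vec.span_scale vec.span_base; simp)
  qed
qed

lemma dim_cone_tangent_affine:
  assumes "b\<^sup>2 = a ^ 3 - a" "c \<noteq> 0"
  shows "vec.dim (cone_tangent (quartic_curve V) (c *s (V *v affine_vec a b))) = 2"
proof -
  let ?t = "vec4 0 (2 * b) (3 * a\<^sup>2 - 1) (4 * a * b)"
  have t0: "?t \<noteq> 0"
  proof
    assume "?t = 0"
    then have "b = 0" "3 * a\<^sup>2 - 1 = 0" by (auto simp: vec4_eq_iff)
    moreover from this have "a ^ 3 - a = 0" using assms(1) by simp
    ultimately have "(1::complex) = 0" by algebra
    then show False by simp
  qed
  have nin: "V *v affine_vec a b \<notin> vec.span {V *v ?t}"
  proof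
    assume "V *v affine_vec a b \<in> vec.span {V *v ?t}"
    then obtain k where "V *v affine_vec a b = k *s (V *v ?t)"
      by (auto simp: vec.span_singleton)
    then have "affine_vec a b = k *s ?t" by (simp flip: embedding_smult add: embedding_eq_iff)
    then show False by (simp add: affine_vec_def vec4_eq_iff)
  qed
  then have "vec.independent {V *v affine_vec a b, V *v ?t}"
    using t0 by (intro vec.independent_insertI) (simp_all add: vec.dependent_single vec.independent_empty)
  moreover have "V *v affine_vec a b \<noteq> V *v ?t" using nin vec.span_base by blast
  ultimately show ?thesis
    unfolding cone_tangent_affine[OF assms]
    by (simp add: vec.dim_span_eq_card_independent del: vec.dim_span)
qed

lemma smooth_quartic_curve: "smooth (quartic_curve V)"
  unfolding smooth_def
proof (intro ballI)
  fix P x assume "P \<in> quartic_curve V" "x \<in> P"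
  then obtain c a b V' W' where *: "c \<noteq> 0" "b\<^sup>2 = a ^ 3 - a" "x = c *s (V' *v affine_vec a b)"
    "quartic_model V' W'" "quartic_curve V' = quartic_curve V"
    by (rule affine_cover)
  have "vec.dim (cone_tangent (quartic_curve V) x) = 2"
    using quartic_model.dim_cone_tangent_affine[OF *(4,2,1)] *(3,5) by simp
  then show "enat (vec.dim (cone_tangent (quartic_curve V) x)) = krull_dim (quartic_curve V) + 1"
    by (simp add: krull_dim_eq_1 one_enat_def)
qed

end

section \<open>The Hilbert function and morphisms given by two charts\<close>

lemma subspace_forms: "cpoly.subspace (forms d)"
  unfolding cpoly.subspace_def forms_def by (simp add: homogeneous_add homogeneous_cscale)

lemma finite_monomials_of_degree: "finite {m :: 'v::finite \<Rightarrow>\<^sub>0 nat. (\<Sum>i\<in>UNIV. Poly_Mapping.lookup m i) = d}"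
proof (rule inj_on_finite[where f = Poly_Mapping.lookup])
  show "inj_on Poly_Mapping.lookup {m :: 'v \<Rightarrow>\<^sub>0 nat. (\<Sum>i\<in>UNIV. Poly_Mapping.lookup m i) = d}"
    by (rule inj_onI) (simp only: poly_mapping_eq_iff)
  show "Poly_Mapping.lookup ` {m :: 'v \<Rightarrow>\<^sub>0 nat. (\<Sum>i\<in>UNIV. Poly_Mapping.lookup m i) = d} \<subseteq> Pi\<^sub>E UNIV (\<lambda>_. {..d})"
  proof clarify
    fix m :: "'v \<Rightarrow>\<^sub>0 nat"
    assume "d = (\<Sum>i\<in>UNIV. Poly_Mapping.lookup m i)"
    then show "Poly_Mapping.lookup m \<in> Pi\<^sub>E UNIV (\<lambda>_. {..\<Sum>i\<in>UNIV. Poly_Mapping.lookup m i})"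
      by (simp add: PiE_UNIV_domain member_le_sum)
  qed
  show "finite (Pi\<^sub>E (UNIV :: 'v set) (\<lambda>_. {..d}))"
    by (intro finite_PiE) simp_all
qed

lemma forms_finitely_spanned:
  obtains T where "finite T" "(forms d :: 'v::finite cpoly set) \<subseteq> cpoly.span T"
proof -
  let ?M = "{m :: 'v \<Rightarrow>\<^sub>0 nat. (\<Sum>i\<in>UNIV. Poly_Mapping.lookup m i) = d}"
  let ?T = "(\<lambda>m. Poly_Mapping.single m (1 :: complex)) ` ?M"
  have "f \<in> cpoly.span ?T" if "f \<in> forms d" for f
  proof -
    have "f = (\<Sum>m\<in>Poly_Mapping.keys f. cscale (Poly_Mapping.lookup f m) (Poly_Mapping.single m 1))"
      using poly_mapping_sum_single[of f] by (simp add: cscale_def mult_single)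
    also have "\<dots> \<in> cpoly.span ?T"
      using that by (intro cpoly.span_sum cpoly.span_scale cpoly.span_base)
        (auto simp: forms_def homogeneous_def)
    finally show ?thesis .
  qed
  then show ?thesis using that[of ?T] finite_monomials_of_degree by blast
qed

text \<open>
  The ambient space of all polynomials has infinite dimension, so instead of counting ranks the proof
  extends a basis of the kernel by one vector to a basis of \<open>U\<close>.
\<close>

lemma dim_kernel_functional:
  assumes U: "cpoly.subspace U" "U \<subseteq> cpoly.span T" "finite T"
    and add: "\<And>f g. f \<in> U \<Longrightarrow> g \<in> U \<Longrightarrow> \<phi> (f + g) = \<phi> f + \<phi> g"
    and scale: "\<And>a f. f \<in> U \<Longrightarrow> \<phi> (cscale a f) = a * \<phi> f"
    and b: "b \<in> U" "\<phi> b = 1"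
  shows "cpoly.dim U = cpoly.dim {f \<in> U. \<phi> f = 0} + 1"
proof -
  let ?N = "{f \<in> U. \<phi> f = 0}"
  have N: "cpoly.subspace ?N"
    using U(1) add scale scale[of 0 0] unfolding cpoly.subspace_def by auto
  obtain B where B: "B \<subseteq> ?N" "cpoly.independent B" "?N \<subseteq> cpoly.span B" "card B = cpoly.dim ?N"
    using cpoly.basis_exists by blast
  have "B \<subseteq> cpoly.span T" using B(1) U(2) by blast
  then have fin: "finite B" using cpoly.independent_span_bound[OF U(3) B(2)] by blast
  have "cpoly.span B \<subseteq> ?N" using B(1) N by (rule cpoly.span_minimal)
  then have nb: "b \<notin> cpoly.span B" using b(2) by auto
  then have ind: "cpoly.independent (insert b B)" using B(2) by (rule cpoly.independent_insertI)
  have "U \<subseteq> cpoly.span (insert b B)"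
  proof
    fix f assume f: "f \<in> U"
    have sb: "cscale (- \<phi> f) b \<in> U" using U(1) b(1) by (rule cpoly.subspace_scale)
    moreover have "\<phi> (f + cscale (- \<phi> f) b) = 0"
      unfolding add[OF f sb] scale[OF b(1)] b(2) by simp
    ultimately have "f + cscale (- \<phi> f) b \<in> ?N"
      using cpoly.subspace_add[OF U(1) f] by blast
    then have "f + cscale (- \<phi> f) b \<in> cpoly.span (insert b B)"
      using B(3) cpoly.span_mono[of B "insert b B"] by blast
    moreover have "cscale (\<phi> f) b \<in> cpoly.span (insert b B)"
      by (intro cpoly.span_scale cpoly.span_base) simp
    ultimately have "(f + cscale (- \<phi> f) b) + cscale (\<phi> f) b \<in> cpoly.span (insert b B)"
      by (rule cpoly.span_add)
    moreover have "(f + cscale (- \<phi> f) b) + cscale (\<phi> f) b = f"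
      by (simp add: cpoly.scale_minus_left)
    ultimately show "f \<in> cpoly.span (insert b B)" by (simp only:)
  qed
  moreover have "insert b B \<subseteq> U" using B(1) b(1) by blast
  ultimately have "cpoly.dim U = card (insert b B)"
    using ind cpoly.basis_card_eq_dim by metis
  moreover have "b \<notin> B" using nb cpoly.span_base by blast
  ultimately show ?thesis using fin B(4) by simp
qed

lemma dim_kernel_functionals:
  assumes "finite J" and U: "cpoly.subspace U" "U \<subseteq> cpoly.span T" "finite T"
    and add: "\<And>j f g. j \<in> J \<Longrightarrow> f \<in> U \<Longrightarrow> g \<in> U \<Longrightarrow> \<phi> j (f + g) = \<phi> j f + \<phi> j g"
    and scale: "\<And>j a f. j \<in> J \<Longrightarrow> f \<in> U \<Longrightarrow> \<phi> j (cscale a f) = a * \<phi> j f"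
    and b: "\<And>j. j \<in> J \<Longrightarrow> b j \<in> U" "\<And>i j. i \<in> J \<Longrightarrow> j \<in> J \<Longrightarrow> \<phi> i (b j) = (if i = j then 1 else 0)"
  shows "cpoly.dim U = cpoly.dim {f \<in> U. \<forall>j\<in>J. \<phi> j f = 0} + card J"
  using assms(1) add scale b
proof (induction J rule: finite_induct)
  case (insert j J)
  let ?N = "{f \<in> U. \<forall>j\<in>J. \<phi> j f = 0}"
  have "cpoly.subspace ?N"
    unfolding cpoly.subspace_def
  proof (intro conjI ballI allI)
    show "0 \<in> ?N"
      using U(1) insert.prems(2)[of _ 0 0] by (auto simp: cpoly.subspace_def)
    show "f + g \<in> ?N" if "f \<in> ?N" "g \<in> ?N" for f g
      using that U(1) insert.prems(1) by (auto simp: cpoly.subspace_def)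
    show "cscale c f \<in> ?N" if "f \<in> ?N" for c f
      using that U(1) insert.prems(2) by (auto simp: cpoly.subspace_def)
  qed
  moreover have "b j \<in> ?N" using insert by auto
  ultimately have "cpoly.dim ?N = cpoly.dim {f \<in> ?N. \<phi> j f = 0} + 1"
    using U insert.prems by (intro dim_kernel_functional[where T = T and b = "b j"]) auto
  moreover have "{f \<in> ?N. \<phi> j f = 0} = {f \<in> U. \<forall>i\<in>insert j J. \<phi> i f = 0}" by auto
  moreover have "cpoly.dim U = cpoly.dim ?N + card J"
    using insert.prems by (intro insert.IH) auto
  ultimately show ?case using insert.hyps by simp
qed simp

lemma restricts_to_cscale:
  assumes "restricts_to d F p q"
  shows "restricts_to d (\<lambda>x y. c * F x y) (smult c p) (smult c q)"
proof -
  have "restricts_to 0 (\<lambda>x y. c) [:c:] 0"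
    by (rule restricts_toI[where h = "\<lambda>z. 0"]) auto
  from restricts_to_mult[OF this assms] show ?thesis by simp
qed

lemma restricts_to_unique:
  assumes "restricts_to d F p q" "restricts_to d F p' q'"
  shows "p = p' \<and> q = q'"
proof -
  have "restricts_to d (\<lambda>x y. F x y + (- 1) * F x y) (p + smult (- 1) p') (q + smult (- 1) q')"
    by (intro restricts_to_add restricts_to_cscale assms)
  then have "p + smult (- 1) p' = 0 \<and> q + smult (- 1) q' = 0"
    by (rule restriction_unique_zero) (use infinite_cubic in simp)
  then show ?thesis by simp
qed

context quartic_model
begin

text \<open>
  Since \<open>1\<close>, \<open>x\<close> and \<open>x\<^sup>2\<close> are coordinates, \<open>d\<close> factors produce every power of \<open>x\<close> up to \<open>x\<close> to the \<open>2 d\<close>.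
\<close>

lemma monomial_on_curve:
  assumes "k \<le> 2 * d"
  obtains f where "homogeneous d f" "\<And>x y. peval f (V *v affine_vec x y) = x ^ k"
proof
  let ?f = "coordinate_form W 1 ^ (d - k div 2 - k mod 2) * coordinate_form W 2 ^ (k mod 2)
      * coordinate_form W 4 ^ (k div 2)"
  have "homogeneous ((d - k div 2 - k mod 2) * 1 + (k mod 2) * 1 + (k div 2) * 1) ?f"
    by (intro homogeneous_mult homogeneous_power homogeneous_coordinate_form)
  moreover have "(d - k div 2 - k mod 2) * 1 + (k mod 2) * 1 + (k div 2) * 1 = d"
    using assms by presburger
  ultimately show "homogeneous d ?f" by simp
  have "x ^ (k mod 2) * (x\<^sup>2) ^ (k div 2) = x ^ k" for x :: complex
    by (simp flip: power_mult power_add)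
  then show "peval ?f (V *v affine_vec x y) = x ^ k" for x y
    by (simp add: affine_vec_def)
qed

text \<open>
  The coefficients of \<open>p\<close> and \<open>q\<close> in the normal form \<open>p(x) + y q(x)\<close> are \<open>(2 d + 1) + (2 d - 1)\<close> linear
  functionals on the forms of degree \<open>d\<close>. Their common kernel consists of the vanishing forms, and forms
  restricting to \<open>x\<^sup>k\<close> and to \<open>y x\<^sup>k\<close> are dual to them.
\<close>

lemma hilbert_fun_quartic_curve:
  assumes "0 < d"
  shows "hilbert_fun (quartic_curve V) d = 4 * d"
proof -
  let ?R = "\<lambda>f. (\<lambda>x y. peval f (V *v affine_vec x y))"
  define res where "res f = (SOME pq. restricts_to d (?R f) (fst pq) (snd pq))" for f
  have res: "restricts_to d (?R f) (fst (res f)) (snd (res f))" if "f \<in> forms d" for f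
  proof -
    have "\<exists>pq. restricts_to d (?R f) (fst pq) (snd pq)"
      using form_restrictable[of d f V] that by (simp add: restrictable_def forms_def)
    then show ?thesis unfolding res_def by (rule someI_ex)
  qed
  have res_eq: "res f = (p, q)" if "f \<in> forms d" "restricts_to d (?R f) p q" for f p q
    using restricts_to_unique[OF res[OF that(1)] that(2)] by (simp add: prod_eq_iff)
  define \<phi> where "\<phi> j f = (case j of Inl k \<Rightarrow> coeff (fst (res f)) k | Inr k \<Rightarrow> coeff (snd (res f)) k)"
    for j :: "nat + nat" and f
  let ?J = "Inl ` {..2 * d} \<union> Inr ` {..<2 * d - 1} :: (nat + nat) set"
  have "\<exists>f\<in>forms d. case j of Inl k \<Rightarrow> res f = (monom 1 k, 0) | Inr k \<Rightarrow> res f = (0, monom 1 k)"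
    if "j \<in> ?J" for j
  proof (cases j)
    case (Inl k)
    with that have k: "k \<le> 2 * d" by auto
    obtain f where f: "homogeneous d f" "\<And>x y. peval f (V *v affine_vec x y) = x ^ k"
      using monomial_on_curve[OF k] by metis
    have "restricts_to d (?R f) (monom 1 k) 0"
      using k by (intro restricts_toI[where h = "\<lambda>z. 0"]) (auto simp: f(2) degree_monom_eq poly_monom)
    then show ?thesis using f(1) res_eq[of f] Inl by (auto simp: forms_def)
  next
    case (Inr k)
    with that have k: "k \<le> 2 * (d - 1)" "k + 2 \<le> 2 * d" by auto
    obtain f where f: "homogeneous (d - 1) f" "\<And>x y. peval f (V *v affine_vec x y) = x ^ k"
      using monomial_on_curve[OF k(1)] by metis
    have "homogeneous (1 + (d - 1)) (coordinate_form W 3 * f)"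
      by (intro homogeneous_mult homogeneous_coordinate_form f)
    then have "coordinate_form W 3 * f \<in> forms d" using assms by (simp add: forms_def)
    moreover have "restricts_to d (?R (coordinate_form W 3 * f)) 0 (monom 1 k)"
      using k(2) by (intro restricts_toI[where h = "\<lambda>z. 0"])
        (auto simp: f(2) degree_monom_eq poly_monom mult_monom affine_vec_nth)
    ultimately show ?thesis using res_eq[of "coordinate_form W 3 * f"] Inr by auto
  qed
  then obtain b where b: "\<And>j. j \<in> ?J \<Longrightarrow> b j \<in> forms d"
    "\<And>j. j \<in> ?J \<Longrightarrow> (case j of Inl k \<Rightarrow> res (b j) = (monom 1 k, 0) | Inr k \<Rightarrow> res (b j) = (0, monom 1 k))"
    by metis
  obtain T where T: "finite T" "(forms d :: 'v cpoly set) \<subseteq> cpoly.span T"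
    using forms_finitely_spanned by blast
  have add: "res (f + g) = (fst (res f) + fst (res g), snd (res f) + snd (res g))"
    if "f \<in> forms d" "g \<in> forms d" for f g
    using restricts_to_add[OF res[OF that(1)] res[OF that(2)]] that
    by (intro res_eq cpoly.subspace_add[OF subspace_forms]) simp_all
  have scale: "res (cscale a f) = (smult a (fst (res f)), smult a (snd (res f)))"
    if "f \<in> forms d" for a f
    using restricts_to_cscale[OF res[OF that], of a] that
    by (intro res_eq cpoly.subspace_scale[OF subspace_forms]) simp_all
  have "cpoly.dim (forms d :: 'v cpoly set) = cpoly.dim {f \<in> forms d. \<forall>j\<in>?J. \<phi> j f = 0} + card ?J"
  proof (rule dim_kernel_functionals[where T = T and b = b])
    show "cpoly.subspace (forms d :: 'v cpoly set)" "forms d \<subseteq> cpoly.span T" "finite T"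
      using subspace_forms T by blast+
    show "\<phi> i (b j) = (if i = j then 1 else 0)" if "i \<in> ?J" "j \<in> ?J" for i j
      using b(2)[OF that(2)] by (auto simp: \<phi>_def split: sum.splits)
  qed (use b(1) add scale in \<open>auto simp: \<phi>_def split: sum.splits\<close>)
  moreover have "{f \<in> forms d. \<forall>j\<in>?J. \<phi> j f = 0} = vanishing_forms (quartic_curve V) d"
  proof (intro set_eqI iffI)
    fix f assume f: "f \<in> {f \<in> forms d. \<forall>j\<in>?J. \<phi> j f = 0}"
    then have R: "restricts_to d (?R f) (fst (res f)) (snd (res f))" using res by blast
    have "fst (res f) = 0"
    proof (rule ccontr)
      assume nz: "fst (res f) \<noteq> 0"
      have "Inl (degree (fst (res f))) \<in> ?J" using R by (auto simp: restricts_to_def)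
      with f have "\<phi> (Inl (degree (fst (res f)))) f = 0" by blast
      with nz show False by (simp add: \<phi>_def)
    qed
    moreover have "snd (res f) = 0"
    proof (rule ccontr)
      assume nz: "snd (res f) \<noteq> 0"
      then have "2 + degree (snd (res f)) \<le> 2 * d"
        using R by (simp add: restricts_to_def degree_mult_eq degree_monom_eq)
      then have "Inr (degree (snd (res f))) \<in> ?J" by auto
      with f have "\<phi> (Inr (degree (snd (res f)))) f = 0" by blast
      with nz show False by (simp add: \<phi>_def)
    qed
    ultimately show "f \<in> vanishing_forms (quartic_curve V) d"
      using vanishing_form_iff_restriction_zero[OF _ R] f by (simp add: forms_def)
  next
    fix f assume f: "f \<in> vanishing_forms (quartic_curve V) d"
    then have fd: "f \<in> forms d" by (simp add: vanishing_forms_def)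
    then have "fst (res f) = 0 \<and> snd (res f) = 0"
      using vanishing_form_iff_restriction_zero[OF _ res[OF fd]] f by (simp add: forms_def)
    with fd show "f \<in> {f \<in> forms d. \<forall>j\<in>?J. \<phi> j f = 0}" by (auto simp: \<phi>_def)
  qed
  moreover have "card ?J = 4 * d"
    using assms by (subst card_Un_disjoint) (auto simp: card_image)
  ultimately show ?thesis by (simp add: hilbert_fun_def)
qed

lemma curve_genus_quartic_curve: "curve_genus (quartic_curve V) 1"
  unfolding curve_genus_def
proof (intro exI conjI)
  show "\<forall>\<^sub>F d in sequentially. of_nat (hilbert_fun (quartic_curve V) d) = poly [:0, 4 :: rat:] (of_nat d)"
    using eventually_gt_at_top[of 0] by eventually_elim (simp add: hilbert_fun_quartic_curve)
qed simp

end

text \<open>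
  Two systems of forms that agree where both are nonzero glue to a morphism. Its value at a point is
  read off from an arbitrary representative.
\<close>

lemma morphism_from_charts:
  fixes G H :: "'w::finite \<Rightarrow> 'v::finite cpoly"
  defines "g \<equiv> \<lambda>x. \<chi> j. peval (G j) x" and "h \<equiv> \<lambda>x. \<chi> j. peval (H j) x"
  assumes X: "X \<subseteq> proj_space"
    and G: "\<And>j. homogeneous d (G j)" "\<And>j. coeffs_in K (G j)"
    and H: "\<And>j. homogeneous e (H j)" "\<And>j. coeffs_in K (H j)"
    and cover: "\<And>P x. P \<in> X \<Longrightarrow> x \<in> P \<Longrightarrow> g x \<noteq> 0 \<or> h x \<noteq> 0"
    and agree: "\<And>P x. P \<in> X \<Longrightarrow> x \<in> P \<Longrightarrow> g x \<noteq> 0 \<Longrightarrow> h x \<noteq> 0 \<Longrightarrow> proj_point (g x) = proj_point (h x)"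
    and target: "\<And>P x. P \<in> X \<Longrightarrow> x \<in> P \<Longrightarrow> g x \<noteq> 0 \<Longrightarrow> proj_point (g x) \<in> Y"
      "\<And>P x. P \<in> X \<Longrightarrow> x \<in> P \<Longrightarrow> h x \<noteq> 0 \<Longrightarrow> proj_point (h x) \<in> Y"
  shows "\<exists>\<phi>. morphism_over K X Y \<phi> \<and> (\<forall>P\<in>X. \<forall>x\<in>P.
    (g x \<noteq> 0 \<longrightarrow> \<phi> P = proj_point (g x)) \<and> (h x \<noteq> 0 \<longrightarrow> \<phi> P = proj_point (h x)))"
proof -
  let ?val = "\<lambda>x. proj_point (if g x \<noteq> 0 then g x else h x)"
  define \<phi> where "\<phi> P = ?val (SOME x. x \<in> P)" for P
  have gs: "g (c *s x) = c ^ d *s g x" for c x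
    by (simp add: g_def vec_eq_iff peval_scale[OF G(1)])
  have hs: "h (c *s x) = c ^ e *s h x" for c x
    by (simp add: h_def vec_eq_iff peval_scale[OF H(1)])
  have val: "?val (c *s x) = ?val x" if "c \<noteq> 0" for c x
    using that by (simp add: gs hs proj_point_smult)
  have point: "\<exists>z. P = proj_point z" if "P \<in> X" for P
    using X that by (auto simp: proj_space_def)
  have \<phi>: "\<phi> P = ?val x" if "P \<in> X" "x \<in> P" for P x
  proof -
    obtain z where z: "P = proj_point z" using point[OF \<open>P \<in> X\<close>] by blast
    have "?val y = ?val z" if "y \<in> P" for y
    proof -
      from \<open>y \<in> P\<close> obtain c where "c \<noteq> 0" "y = c *s z" unfolding z proj_point_def by blast
      show ?thesis unfolding \<open>y = c *s z\<close> by (rule val[OF \<open>c \<noteq> 0\<close>])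
    qed
    moreover have "(SOME x. x \<in> P) \<in> P" using that(2) by (rule someI)
    ultimately show ?thesis unfolding \<phi>_def using that(2) by simp
  qed
  have 1: "\<phi> P = proj_point (g x)" if "P \<in> X" "x \<in> P" "g x \<noteq> 0" for P x
    using \<phi>[OF that(1,2)] that(3) by simp
  have 2: "\<phi> P = proj_point (h x)" if "P \<in> X" "x \<in> P" "h x \<noteq> 0" for P x
    using \<phi>[OF that(1,2)] that(3) agree[OF that(1,2)] by auto
  have "morphism_over K X Y \<phi>"
    unfolding morphism_over_def
  proof (intro conjI ballI)
    show "\<phi> ` X \<subseteq> Y"
    proof
      fix R assume "R \<in> \<phi> ` X"
      then obtain P where P: "P \<in> X" "R = \<phi> P" by blast
      with point obtain x where "P = proj_point x" by blast
      then have "x \<in> P" by simp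
      then show "R \<in> Y" using P 1 2 target cover by metis
    qed
    fix P assume P: "P \<in> X"
    with point obtain z where z: "P = proj_point z" by blast
    have ngz: "g x \<noteq> 0" if "x \<in> P" "g z \<noteq> 0" for x
      using that unfolding z proj_point_def by (auto simp: gs)
    have nhz: "h x \<noteq> 0" if "x \<in> P" "h z \<noteq> 0" for x
      using that unfolding z proj_point_def by (auto simp: hs)
    show "\<exists>d g. (\<forall>j. homogeneous d (g j) \<and> coeffs_in K (g j)) \<and>
        (\<forall>x\<in>P. (\<chi> j. peval (g j) x) \<noteq> 0) \<and>
        (\<forall>Q\<in>X. \<forall>x\<in>Q. (\<chi> j. peval (g j) x) \<noteq> 0 \<longrightarrow> \<phi> Q = proj_point (\<chi> j. peval (g j) x))"
    proof (cases "g z = 0")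
      case False
      then show ?thesis
        using G 1 ngz unfolding g_def by (intro exI[of _ d] exI[of _ G]) blast
    next
      case True
      then have "h z \<noteq> 0" using cover[OF P] z by auto
      then show ?thesis
        using H 2 nhz unfolding h_def by (intro exI[of _ e] exI[of _ H]) blast
    qed
  qed
  then show ?thesis using 1 2 by blast
qed

section \<open>Isomorphism with the Weierstrass cubic\<close>

lemma (in complex_subring) sum_mem: "(\<And>i. i \<in> I \<Longrightarrow> f i \<in> K) \<Longrightarrow> sum f I \<in> K"
  by (induction I rule: infinite_finite_induct) (auto intro: add_mem)

locale quartic_model_over = quartic_model V W + complex_subring K
  for V :: "complex ^ 4 ^ 'v::finite" and W :: "complex ^ 'v ^ 4" and K +
  assumes V_mem: "V $ i $ k \<in> K" and W_mem: "W $ k $ i \<in> K"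
begin

lemma proj_closed_over_quartic_curve: "proj_closed_over K (quartic_curve V)"
proof -
  have "(V ** W) $ i $ j \<in> K" for i j
    by (simp add: matrix_matrix_mult_def V_mem W_mem sum_mem mult_mem)
  then have "coeffs_in K f" if "f \<in> quartic_equations V W" for f
    using that unfolding quartic_equations_def
    by (auto intro!: coeffs_in_diff coeffs_in_mult coeffs_in_power coeffs_in_coordinate_form W_mem)
  then show ?thesis
    unfolding proj_closed_over_def quartic_curve_eq_proj_zeros
    using quartic_equations_homogeneous by blast
qed

lemma elliptic_curve_quartic_curve: "elliptic_curve K (quartic_curve V)"
proof -
  have "proj_point (V *v vec4 0 0 0 1) \<in> quartic_curve V"
    by (intro proj_point_in_quartic_curve) (simp_all add: quartic_cone_def vec4_eq_iff)
  moreover have "rational_point K (proj_point (V *v vec4 0 0 0 1))"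
    unfolding rational_point_def
    by (intro bexI[of _ "V *v vec4 0 0 0 1"])
      (simp_all add: matrix_vector_mult_def sum_4 V_mem)
  ultimately show ?thesis
    unfolding elliptic_curve_def
    using proj_closed_over_quartic_curve irreducible krull_dim_eq_1 smooth_quartic_curve
      curve_genus_quartic_curve by blast
qed

end

definition vec3 :: "'a \<Rightarrow> 'a \<Rightarrow> 'a \<Rightarrow> 3 \<Rightarrow> 'a" where
  "vec3 a b c j = (if j = 1 then a else if j = 2 then b else c)"

lemma vec3_cases: "P a \<Longrightarrow> P b \<Longrightarrow> P c \<Longrightarrow> P (vec3 a b c j)"
  by (simp add: vec3_def)

definition point3 :: "complex \<Rightarrow> complex \<Rightarrow> complex \<Rightarrow> complex ^ 3" where
  "point3 a b c = (\<chi> j. vec3 a b c j)"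

lemma point3_nth [simp]: "point3 a b c $ 1 = a" "point3 a b c $ 2 = b" "point3 a b c $ 3 = c"
  by (simp_all add: point3_def vec3_def)

lemma point3_eq_iff: "(u :: complex ^ 3) = v \<longleftrightarrow> u $ 1 = v $ 1 \<and> u $ 2 = v $ 2 \<and> u $ 3 = v $ 3"
  by (simp add: vec_eq_iff forall_3)

lemma peval_vec3: "(\<chi> j. peval (vec3 f g h j) x) = point3 (peval f x) (peval g x) (peval h x)"
  by (simp add: point3_eq_iff vec3_def)

lemma proj_point_in_weierstrass_curve:
  "proj_point u \<in> weierstrass_curve \<longleftrightarrow>
     u \<noteq> 0 \<and> (u $ 2)\<^sup>2 * u $ 3 = (u $ 1) ^ 3 - u $ 1 * (u $ 3)\<^sup>2"
proof -
  have "homogeneous (1 + 1 + 1) (Var 2 ^ 2 * Var 3 - (Var 1 ^ 3 - Var 1 * Var 3 ^ 2) :: 3 cpoly)"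
    unfolding power2_eq_square power3_eq_cube mult.assoc[symmetric]
    by (intro homogeneous_diff homogeneous_mult homogeneous_Var)
  then show ?thesis
    unfolding weierstrass_curve_def by (subst proj_point_in_proj_zeros) auto
qed

lemma weierstrass_curve_cases:
  assumes "P \<in> weierstrass_curve" "x \<in> P"
  obtains (affine) c a b where "c \<noteq> 0" "b\<^sup>2 = a ^ 3 - a" "x = c *s point3 a b 1" "P = proj_point (point3 a b 1)"
  | (infinity) c where "c \<noteq> 0" "x = c *s point3 0 1 0" "P = proj_point (point3 0 1 0)"
proof -
  obtain z where "P = proj_point z"
    using assms(1) by (auto simp: weierstrass_curve_def proj_zeros_def elim: proj_spaceE)
  with assms(2) have P: "P = proj_point x" using proj_point_eqI by blast
  have x: "x \<noteq> 0" "(x $ 2)\<^sup>2 * x $ 3 = (x $ 1) ^ 3 - x $ 1 * (x $ 3)\<^sup>2"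
    using assms(1) unfolding P proj_point_in_weierstrass_curve by auto
  show ?thesis
  proof (cases "x $ 3 = 0")
    case True
    with x(2) have "x $ 1 = 0" by simp
    with True have eq: "x = (x $ 2) *s point3 0 1 0" by (simp add: point3_eq_iff)
    moreover from eq x(1) have "x $ 2 \<noteq> 0" by (metis vector_smult_lzero)
    ultimately show ?thesis using infinity[of "x $ 2"] P proj_point_smult by metis
  next
    case False
    define a b where "a = x $ 1 / x $ 3" and "b = x $ 2 / x $ 3"
    have eq: "x = (x $ 3) *s point3 a b 1"
      using False by (simp add: point3_eq_iff a_def b_def)
    have "x $ 1 = a * x $ 3" "x $ 2 = b * x $ 3" using False by (simp_all add: a_def b_def)
    with x(2) have "(x $ 3) ^ 3 * (b\<^sup>2 - (a ^ 3 - a)) = 0" by (simp add: power2_eq_square power3_eq_cube algebra_simps)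
    with False have "b\<^sup>2 = a ^ 3 - a" by simp
    then show ?thesis using affine[of "x $ 3" b a] eq P False proj_point_smult by metis
  qed
qed

context quartic_model
begin

lemma quartic_curve_cases:
  assumes "P \<in> quartic_curve V" "x \<in> P"
  obtains (affine) c a b where "c \<noteq> 0" "b\<^sup>2 = a ^ 3 - a" "x = c *s (V *v affine_vec a b)"
      "P = proj_point (V *v affine_vec a b)"
  | (infinity) c where "c \<noteq> 0" "x = c *s (V *v vec4 0 0 0 1)" "P = proj_point (V *v vec4 0 0 0 1)"
proof -
  obtain u where u: "u \<in> quartic_cone" "u \<noteq> 0" "x = V *v u" using assms by (rule quartic_curveE)
  have P: "P = proj_point x"
    using assms proj_point_eqI by (auto simp: quartic_curve_def)
  from u(1,2) show ?thesis
  proof (cases rule: quartic_cone_cases)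
    case (affine c a b)
    then show ?thesis using that(1)[of c b a] u(3) P by (simp add: embedding_smult proj_point_smult)
  next
    case (infinity c)
    then show ?thesis using that(2)[of c] u(3) P by (simp add: embedding_smult proj_point_smult)
  qed
qed

end

definition vec4_of :: "'a \<Rightarrow> 'a \<Rightarrow> 'a \<Rightarrow> 'a \<Rightarrow> 4 \<Rightarrow> 'a" where
  "vec4_of a b c d k = (if k = 1 then a else if k = 2 then b else if k = 3 then c else d)"

lemma vec4_of_cases: "P a \<Longrightarrow> P b \<Longrightarrow> P c \<Longrightarrow> P d \<Longrightarrow> P (vec4_of a b c d k)"
  by (simp add: vec4_of_def)

definition linear_combination :: "complex ^ 4 ^ 'v::finite \<Rightarrow> (4 \<Rightarrow> 'w cpoly) \<Rightarrow> 'v \<Rightarrow> 'w cpoly" where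
  "linear_combination V F i = (\<Sum>k\<in>UNIV. cscale (V $ i $ k) (F k))"

lemma peval_linear_combination:
  "(\<chi> i. peval (linear_combination V (vec4_of f1 f2 f3 f4) i) x)
    = V *v vec4 (peval f1 x) (peval f2 x) (peval f3 x) (peval f4 x)"
  by (simp add: vec_eq_iff linear_combination_def matrix_vector_mult_def sum_4 vec4_of_def)

context quartic_model_over
begin

text \<open>
  The projection \<open>(u\<^sub>2 : u\<^sub>3 : u\<^sub>1)\<close> recovers \<open>(x : y : 1)\<close> but is undefined at infinity. The second chart is
  obtained from it by multiplying with \<open>x y\<close> and replacing \<open>x y\<^sup>2\<close> by \<open>(x\<^sup>2 - 1) x\<^sup>2\<close>; it
  takes the value \<open>(0 : 1 : 0)\<close> at infinity.
\<close>

lemma coordinates_morphism: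
  obtains \<phi> where "morphism_over K (quartic_curve V) weierstrass_curve \<phi>"
    "\<And>a b. b\<^sup>2 = a ^ 3 - a \<Longrightarrow> \<phi> (proj_point (V *v affine_vec a b)) = proj_point (point3 a b 1)"
    "\<phi> (proj_point (V *v vec4 0 0 0 1)) = proj_point (point3 0 1 0)"
proof -
  let ?l = "coordinate_form W"
  let ?G = "vec3 (?l 2) (?l 3) (?l 1)"
  let ?H = "vec3 (?l 3 * ?l 4) ((?l 4 - ?l 1) * ?l 4) (?l 2 * ?l 3)"
  let ?g = "\<lambda>x. \<chi> j. peval (?G j) x" and ?h = "\<lambda>x. \<chi> j. peval (?H j) x"
  note coeffs = coeffs_in_coordinate_form[OF W_mem] coeffs_in_mult coeffs_in_diff
  have G: "homogeneous 1 (?G j)" "coeffs_in K (?G j)" for j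
    by (intro vec3_cases[of "homogeneous _"] vec3_cases[of "coeffs_in K"] homogeneous_coordinate_form coeffs)+
  have H: "homogeneous (1 + 1) (?H j)" "coeffs_in K (?H j)" for j
    by (intro vec3_cases[of "homogeneous _"] vec3_cases[of "coeffs_in K"] homogeneous_mult homogeneous_diff homogeneous_coordinate_form coeffs)+
  have W: "W *v (c *s (V *v u)) = c *s u" for c u
    by (simp add: vector_scalar_commute)
  have g_aff: "?g (c *s (V *v affine_vec a b)) = c *s point3 a b 1" for c a b
    by (simp add: peval_vec3 W affine_vec_nth point3_eq_iff)
  have h_aff: "?h (c *s (V *v affine_vec a b)) = (c\<^sup>2 * a * b) *s point3 a b 1"
    if "b\<^sup>2 = a ^ 3 - a" for c a b
  proof -
    have "c * (a\<^sup>2 - 1) * (c * a\<^sup>2) = c\<^sup>2 * a * b * b" using that by algebra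
    then show ?thesis
      by (simp add: peval_vec3 W affine_vec_nth point3_eq_iff) (simp add: power2_eq_square algebra_simps)
  qed
  have g_inf: "?g (c *s (V *v vec4 0 0 0 1)) = 0" for c
    by (simp add: peval_vec3 W point3_eq_iff)
  have h_inf: "?h (c *s (V *v vec4 0 0 0 1)) = c\<^sup>2 *s point3 0 1 0" for c
    by (simp add: peval_vec3 W point3_eq_iff power2_eq_square)
  have nz: "point3 a b 1 \<noteq> 0" "point3 0 1 0 \<noteq> 0" for a b by (simp_all add: point3_eq_iff)
  have on_aff: "proj_point (point3 a b 1) \<in> weierstrass_curve" if "b\<^sup>2 = a ^ 3 - a" for a b
    using that nz by (simp add: proj_point_in_weierstrass_curve)
  have on_inf: "proj_point (point3 0 1 0) \<in> weierstrass_curve"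
    using nz by (simp add: proj_point_in_weierstrass_curve)
  have "\<exists>\<phi>. morphism_over K (quartic_curve V) weierstrass_curve \<phi> \<and> (\<forall>P\<in>quartic_curve V. \<forall>x\<in>P.
    (?g x \<noteq> 0 \<longrightarrow> \<phi> P = proj_point (?g x)) \<and> (?h x \<noteq> 0 \<longrightarrow> \<phi> P = proj_point (?h x)))"
  proof (rule morphism_from_charts[OF quartic_curve_subset G H])
    fix P x assume P: "P \<in> quartic_curve V" "x \<in> P"
    from P show "?g x \<noteq> 0 \<or> ?h x \<noteq> 0"
      by (cases rule: quartic_curve_cases) (simp_all only: g_aff h_inf, simp_all add: nz)
    from P show "proj_point (?g x) = proj_point (?h x)" if "?g x \<noteq> 0" "?h x \<noteq> 0"
    proof (cases rule: quartic_curve_cases)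
      case (affine c a b)
      then show ?thesis
        using that(2) unfolding affine(3) g_aff h_aff[OF affine(2)] by (simp add: proj_point_smult)
    next
      case (infinity c)
      then show ?thesis using that(1) by (simp only: g_inf)
    qed
    from P show "proj_point (?g x) \<in> weierstrass_curve" if "?g x \<noteq> 0"
    proof (cases rule: quartic_curve_cases)
      case (affine c a b)
      then show ?thesis unfolding affine(3) g_aff by (simp add: proj_point_smult on_aff)
    next
      case (infinity c)
      then show ?thesis using that by (simp only: g_inf)
    qed
    from P show "proj_point (?h x) \<in> weierstrass_curve" if "?h x \<noteq> 0"
    proof (cases rule: quartic_curve_cases)
      case (affine c a b)
      then show ?thesis
        using that unfolding affine(3) h_aff[OF affine(2)] by (simp add: proj_point_smult on_aff)
    next
      case (infinity c)
      then show ?thesis unfolding infinity(2) h_inf by (simp add: proj_point_smult on_inf)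
    qed
  qed
  then obtain \<phi> where \<phi>: "morphism_over K (quartic_curve V) weierstrass_curve \<phi>"
    and charts: "\<forall>P\<in>quartic_curve V. \<forall>x\<in>P.
      (?g x \<noteq> 0 \<longrightarrow> \<phi> P = proj_point (?g x)) \<and> (?h x \<noteq> 0 \<longrightarrow> \<phi> P = proj_point (?h x))"
    by (elim exE conjE) (rule that)
  have chart_g: "\<phi> P = proj_point (?g x)" if "P \<in> quartic_curve V" "x \<in> P" "?g x \<noteq> 0" for P x
    by (rule mp[OF conjunct1[OF bspec[OF bspec[OF charts that(1)] that(2)]] that(3)])
  have chart_h: "\<phi> P = proj_point (?h x)" if "P \<in> quartic_curve V" "x \<in> P" "?h x \<noteq> 0" for P x
    by (rule mp[OF conjunct2[OF bspec[OF bspec[OF charts that(1)] that(2)]] that(3)])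
  show ?thesis
  proof (rule that[OF \<phi>])
    fix a b :: complex assume ab: "b\<^sup>2 = a ^ 3 - a"
    have "?g (V *v affine_vec a b) = point3 a b 1" using g_aff[of 1 a b] by simp
    then show "\<phi> (proj_point (V *v affine_vec a b)) = proj_point (point3 a b 1)"
      using chart_g[OF proj_point_in_quartic_curve[OF affine_vec_in_cone[OF ab] affine_vec_nonzero]
          proj_point_self] nz by simp
  next
    have "?h (V *v vec4 0 0 0 1) = point3 0 1 0" using h_inf[of 1] by simp
    moreover have "vec4 0 0 0 1 \<in> quartic_cone" "vec4 0 0 0 1 \<noteq> 0"
      by (simp_all add: quartic_cone_def vec4_eq_iff)
    ultimately show "\<phi> (proj_point (V *v vec4 0 0 0 1)) = proj_point (point3 0 1 0)"
      using chart_h[OF proj_point_in_quartic_curve proj_point_self] nz by simp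
  qed
qed

text \<open>
  The homogenised embedding \<open>(z\<^sup>2 : x z : y z : x\<^sup>2)\<close> is undefined at infinity. Multiplying it by \<open>x / z\<close> and
  using \<open>x\<^sup>3 = z (y\<^sup>2 + x z)\<close> gives the second chart, which is defined there.
\<close>

lemma embedding_morphism:
  obtains \<psi> where "morphism_over K weierstrass_curve (quartic_curve V) \<psi>"
    "\<And>a b. b\<^sup>2 = a ^ 3 - a \<Longrightarrow> \<psi> (proj_point (point3 a b 1)) = proj_point (V *v affine_vec a b)"
    "\<psi> (proj_point (point3 0 1 0)) = proj_point (V *v vec4 0 0 0 1)"
proof -
  let ?x = "Var 1 :: 3 cpoly" and ?y = "Var 2 :: 3 cpoly" and ?z = "Var 3 :: 3 cpoly"
  let ?G = "linear_combination V (vec4_of (?z * ?z) (?x * ?z) (?y * ?z) (?x * ?x))"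
  let ?H = "linear_combination V (vec4_of (?x * ?z) (?x * ?x) (?x * ?y) (?y * ?y + ?x * ?z))"
  let ?g = "\<lambda>x. \<chi> i. peval (?G i) x" and ?h = "\<lambda>x. \<chi> i. peval (?H i) x"
  have G: "homogeneous (1 + 1) (?G i)" "coeffs_in K (?G i)" for i
    unfolding linear_combination_def
    by (intro homogeneous_sum homogeneous_cscale vec4_of_cases[of "homogeneous _"] vec4_of_cases[of "coeffs_in K"] homogeneous_add homogeneous_mult
        homogeneous_Var coeffs_in_sum coeffs_in_cscale coeffs_in_add coeffs_in_mult coeffs_in_Var V_mem)+
  have H: "homogeneous (1 + 1) (?H i)" "coeffs_in K (?H i)" for i
    unfolding linear_combination_def
    by (intro homogeneous_sum homogeneous_cscale vec4_of_cases[of "homogeneous _"] vec4_of_cases[of "coeffs_in K"] homogeneous_add homogeneous_mult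
        homogeneous_Var coeffs_in_sum coeffs_in_cscale coeffs_in_add coeffs_in_mult coeffs_in_Var V_mem)+
  have g_aff: "?g (c *s point3 a b 1) = c\<^sup>2 *s (V *v affine_vec a b)" for c a b
    unfolding peval_linear_combination embedding_smult[symmetric]
    by (rule arg_cong[of _ _ "(*v) V"]) (simp add: vec4_eq_iff affine_vec_nth power2_eq_square)
  have h_aff: "?h (c *s point3 a b 1) = (c\<^sup>2 * a) *s (V *v affine_vec a b)"
    if "b\<^sup>2 = a ^ 3 - a" for c a b
  proof -
    have "c * b * (c * b) + c * a * c = c\<^sup>2 * a * a\<^sup>2" using that by algebra
    then show ?thesis
      unfolding peval_linear_combination embedding_smult[symmetric]
      by (intro arg_cong[of _ _ "(*v) V"]) (simp add: vec4_eq_iff affine_vec_nth, simp add: power2_eq_square)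
  qed
  have g_inf: "?g (c *s point3 0 1 0) = 0" for c
  proof -
    have "vec4 0 0 0 0 = 0" by (simp add: vec4_eq_iff)
    then show ?thesis unfolding peval_linear_combination by simp
  qed
  have h_inf: "?h (c *s point3 0 1 0) = c\<^sup>2 *s (V *v vec4 0 0 0 1)" for c
    unfolding peval_linear_combination embedding_smult[symmetric]
    by (rule arg_cong[of _ _ "(*v) V"]) (simp add: vec4_eq_iff power2_eq_square)
  have "vec4 0 0 0 1 \<in> quartic_cone" and nz4: "vec4 0 0 0 1 \<noteq> 0"
    by (simp_all add: quartic_cone_def vec4_eq_iff)
  then have on_inf: "proj_point (V *v vec4 0 0 0 1) \<in> quartic_curve V"
    by (rule proj_point_in_quartic_curve)
  have on_aff: "proj_point (V *v affine_vec a b) \<in> quartic_curve V" if "b\<^sup>2 = a ^ 3 - a" for a b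
    by (intro proj_point_in_quartic_curve affine_vec_in_cone that affine_vec_nonzero)
  have nz: "point3 a b 1 \<noteq> 0" "point3 0 1 0 \<noteq> 0" for a b by (simp_all add: point3_eq_iff)
  have W: "weierstrass_curve \<subseteq> proj_space"
    by (auto simp: weierstrass_curve_def proj_zeros_def)
  have "\<exists>\<psi>. morphism_over K weierstrass_curve (quartic_curve V) \<psi> \<and> (\<forall>P\<in>weierstrass_curve. \<forall>x\<in>P.
    (?g x \<noteq> 0 \<longrightarrow> \<psi> P = proj_point (?g x)) \<and> (?h x \<noteq> 0 \<longrightarrow> \<psi> P = proj_point (?h x)))"
  proof (rule morphism_from_charts[OF W G H])
    fix P x assume P: "P \<in> weierstrass_curve" "x \<in> P"
    from P show "?g x \<noteq> 0 \<or> ?h x \<noteq> 0"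
      by (cases rule: weierstrass_curve_cases) (simp_all only: g_aff h_inf, simp_all add: nz4)
    from P show "proj_point (?g x) = proj_point (?h x)" if "?g x \<noteq> 0" "?h x \<noteq> 0"
    proof (cases rule: weierstrass_curve_cases)
      case (affine c a b)
      then show ?thesis
        using that(2) unfolding affine(3) g_aff h_aff[OF affine(2)] by (simp add: proj_point_smult)
    next
      case (infinity c)
      then show ?thesis using that(1) by (simp only: g_inf)
    qed
    from P show "proj_point (?g x) \<in> quartic_curve V" if "?g x \<noteq> 0"
    proof (cases rule: weierstrass_curve_cases)
      case (affine c a b)
      then show ?thesis unfolding affine(3) g_aff by (simp add: proj_point_smult on_aff)
    next
      case (infinity c)
      then show ?thesis using that by (simp only: g_inf)
    qed
    from P show "proj_point (?h x) \<in> quartic_curve V" if "?h x \<noteq> 0"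
    proof (cases rule: weierstrass_curve_cases)
      case (affine c a b)
      then show ?thesis
        using that unfolding affine(3) h_aff[OF affine(2)] by (simp add: proj_point_smult on_aff)
    next
      case (infinity c)
      then show ?thesis unfolding infinity(2) h_inf by (simp add: proj_point_smult on_inf)
    qed
  qed
  then obtain \<psi> where \<psi>: "morphism_over K weierstrass_curve (quartic_curve V) \<psi>"
    and charts: "\<forall>P\<in>weierstrass_curve. \<forall>x\<in>P.
      (?g x \<noteq> 0 \<longrightarrow> \<psi> P = proj_point (?g x)) \<and> (?h x \<noteq> 0 \<longrightarrow> \<psi> P = proj_point (?h x))"
    by (elim exE conjE) (rule that)
  have chart_g: "\<psi> P = proj_point (?g x)" if "P \<in> weierstrass_curve" "x \<in> P" "?g x \<noteq> 0" for P x
    by (rule mp[OF conjunct1[OF bspec[OF bspec[OF charts that(1)] that(2)]] that(3)])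
  have chart_h: "\<psi> P = proj_point (?h x)" if "P \<in> weierstrass_curve" "x \<in> P" "?h x \<noteq> 0" for P x
    by (rule mp[OF conjunct2[OF bspec[OF bspec[OF charts that(1)] that(2)]] that(3)])
  show ?thesis
  proof (rule that[OF \<psi>])
    fix a b :: complex assume ab: "b\<^sup>2 = a ^ 3 - a"
    have P: "proj_point (point3 a b 1) \<in> weierstrass_curve"
      using ab nz by (simp add: proj_point_in_weierstrass_curve)
    have "?g (point3 a b 1) = V *v affine_vec a b" using g_aff[of 1 a b] by simp
    then show "\<psi> (proj_point (point3 a b 1)) = proj_point (V *v affine_vec a b)"
      using chart_g[OF P proj_point_self] by simp
  next
    have P: "proj_point (point3 0 1 0) \<in> weierstrass_curve"
      using nz by (simp add: proj_point_in_weierstrass_curve)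
    have "?h (point3 0 1 0) = V *v vec4 0 0 0 1" using h_inf[of 1] by simp
    then show "\<psi> (proj_point (point3 0 1 0)) = proj_point (V *v vec4 0 0 0 1)"
      using chart_h[OF P proj_point_self] nz4 by simp
  qed
qed

lemma isomorphic_weierstrass_curve: "isomorphic_over K (quartic_curve V) weierstrass_curve"
proof -
  obtain \<phi> where \<phi>: "morphism_over K (quartic_curve V) weierstrass_curve \<phi>"
    "\<And>a b. b\<^sup>2 = a ^ 3 - a \<Longrightarrow> \<phi> (proj_point (V *v affine_vec a b)) = proj_point (point3 a b 1)"
    "\<phi> (proj_point (V *v vec4 0 0 0 1)) = proj_point (point3 0 1 0)"
    using coordinates_morphism by blast
  obtain \<psi> where \<psi>: "morphism_over K weierstrass_curve (quartic_curve V) \<psi>"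
    "\<And>a b. b\<^sup>2 = a ^ 3 - a \<Longrightarrow> \<psi> (proj_point (point3 a b 1)) = proj_point (V *v affine_vec a b)"
    "\<psi> (proj_point (point3 0 1 0)) = proj_point (V *v vec4 0 0 0 1)"
    using embedding_morphism by blast
  have "\<psi> (\<phi> P) = P" if P: "P \<in> quartic_curve V" for P
  proof -
    obtain z where "z \<in> P" using P by (auto simp: quartic_curve_def intro: proj_point_self)
    with P show ?thesis
      by (cases rule: quartic_curve_cases) (simp_all add: \<phi> \<psi>)
  qed
  moreover have "\<phi> (\<psi> P) = P" if P: "P \<in> weierstrass_curve" for P
  proof -
    have "P \<in> proj_space" using P by (simp add: weierstrass_curve_def proj_zeros_def)
    then obtain z where "P = proj_point z" by (rule proj_spaceE)
    then have "z \<in> P" by simp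
    with P show ?thesis
      by (cases rule: weierstrass_curve_cases) (simp_all add: \<phi> \<psi>)
  qed
  ultimately show ?thesis unfolding isomorphic_over_def using \<phi>(1) \<psi>(1) by blast
qed

end


section \<open>The sixteen curves in the hyperplane section\<close>

text \<open>
  Applied to \<open>(1, x, y, x\<^sup>2)\<close> the first four rows are the square roots from the duplication formula:
  \<open>C / A\<close>, \<open>D / A\<close> and \<open>B / (\<i> A)\<close> are square roots of \<open>X\<close>, \<open>X - 1\<close> and \<open>X + 1\<close> for \<open>X = x (2P)\<close>. The parameters
  \<open>e\<close>, \<open>f\<close>, \<open>g\<close>, \<open>h\<close> are the ratios \<open>E / D\<close>, \<open>F / C\<close>, \<open>G / B\<close>, \<open>H / A\<close>.
\<close>

definition magic_matrix :: "complex \<Rightarrow> complex \<Rightarrow> complex \<Rightarrow> complex \<Rightarrow> complex ^ 4 ^ entry" where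
  "magic_matrix e f g h = (\<chi> i. case i of
     eA \<Rightarrow> vec4 0 0 2 0 | eB \<Rightarrow> vec4 (- \<i>) (2 * \<i>) 0 \<i> | eC \<Rightarrow> vec4 1 0 0 1
   | eD \<Rightarrow> vec4 (- 1) (- 2) 0 1 | eM \<Rightarrow> vec4 0 0 0 0
   | eE \<Rightarrow> e *s vec4 (- 1) (- 2) 0 1 | eF \<Rightarrow> f *s vec4 1 0 0 1
   | eG \<Rightarrow> g *s vec4 (- \<i>) (2 * \<i>) 0 \<i> | eH \<Rightarrow> h *s vec4 0 0 2 0)"

definition entry_vec :: "complex \<Rightarrow> complex \<Rightarrow> complex \<Rightarrow> complex \<Rightarrow> complex ^ entry" where
  "entry_vec a b c d = (\<chi> i. case i of eA \<Rightarrow> a | eB \<Rightarrow> b | eC \<Rightarrow> c | eD \<Rightarrow> d | _ \<Rightarrow> 0)"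

text \<open>
  A left inverse of \<open>magic_matrix\<close> that reads the entries \<open>A\<close>, \<open>B\<close>, \<open>C\<close>, \<open>D\<close> only, so that one matrix serves
  all sixteen sign choices.
\<close>

definition magic_coordinates :: "complex ^ entry ^ 4" where
  "magic_coordinates = (\<chi> k. if k = 1 then entry_vec 0 (\<i> / 4) (1/2) (- 1/4)
     else if k = 2 then entry_vec 0 (- \<i> / 4) 0 (- 1/4)
     else if k = 3 then entry_vec (1/2) 0 0 0
     else entry_vec 0 (- \<i> / 4) (1/2) (1/4))"

lemma UNIV_entry: "UNIV = {eA, eB, eC, eD, eM, eE, eF, eG, eH}"
  by (auto intro: entry.exhaust)

lemma sum_entry: "sum f (UNIV :: entry set) =
    f eA + f eB + f eC + f eD + f eM + f eE + f eF + f eG + f eH"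
  by (simp add: UNIV_entry add.assoc)

lemma entry_eq_iff: "(x :: complex ^ entry) = y \<longleftrightarrow> x $ eA = y $ eA \<and> x $ eB = y $ eB \<and> x $ eC = y $ eC
    \<and> x $ eD = y $ eD \<and> x $ eM = y $ eM \<and> x $ eE = y $ eE \<and> x $ eF = y $ eF \<and> x $ eG = y $ eG \<and> x $ eH = y $ eH"
proof
  assume "x $ eA = y $ eA \<and> x $ eB = y $ eB \<and> x $ eC = y $ eC
    \<and> x $ eD = y $ eD \<and> x $ eM = y $ eM \<and> x $ eE = y $ eE \<and> x $ eF = y $ eF \<and> x $ eG = y $ eG \<and> x $ eH = y $ eH"
  then have "x $ i = y $ i" for i by (cases i) simp_all
  then show "x = y" by (simp add: vec_eq_iff)
qed simp

lemma magic_matrix_mult_vec: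
  "(magic_matrix e f g h *v u) $ eA = 2 * u $ 3"
  "(magic_matrix e f g h *v u) $ eB = \<i> * (u $ 4 + 2 * u $ 2 - u $ 1)"
  "(magic_matrix e f g h *v u) $ eC = u $ 4 + u $ 1"
  "(magic_matrix e f g h *v u) $ eD = u $ 4 - 2 * u $ 2 - u $ 1"
  "(magic_matrix e f g h *v u) $ eM = 0"
  "(magic_matrix e f g h *v u) $ eE = e * (u $ 4 - 2 * u $ 2 - u $ 1)"
  "(magic_matrix e f g h *v u) $ eF = f * (u $ 4 + u $ 1)"
  "(magic_matrix e f g h *v u) $ eG = g * (\<i> * (u $ 4 + 2 * u $ 2 - u $ 1))"
  "(magic_matrix e f g h *v u) $ eH = h * (2 * u $ 3)"
  by (simp_all add: magic_matrix_def matrix_vector_mult_def sum_4 algebra_simps)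

lemma magic_coordinates_mult_vec:
  "magic_coordinates *v x = vec4 (x $ eC / 2 - (x $ eD - \<i> * x $ eB) / 4) (- (\<i> * x $ eB + x $ eD) / 4)
     (x $ eA / 2) (x $ eC / 2 + (x $ eD - \<i> * x $ eB) / 4)"
  by (simp add: vec4_eq_iff magic_coordinates_def entry_vec_def matrix_vector_mult_def sum_entry field_simps)

lemma gauss_rat_ring: "complex_subring gauss_rat"
  by unfold_locales (auto simp: gauss_rat_def)

lemma quartic_model_over_magic_matrix:
  assumes "{e, f, g, h} \<subseteq> {\<i>, - \<i>}"
  shows "quartic_model_over (magic_matrix e f g h) magic_coordinates gauss_rat"
proof -
  interpret complex_subring gauss_rat by (rule gauss_rat_ring)
  have ring: "0 \<in> gauss_rat" "1 \<in> gauss_rat" "- 1 \<in> gauss_rat" "2 \<in> gauss_rat" "- 2 \<in> gauss_rat" "\<i> \<in> gauss_rat"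
    "- \<i> \<in> gauss_rat" "2 * \<i> \<in> gauss_rat" "\<i> / 4 \<in> gauss_rat" "1 / 2 \<in> gauss_rat"
    "- (\<i> / 4) \<in> gauss_rat" "1 / 4 \<in> gauss_rat" "- (1 / 4) \<in> gauss_rat"
    by (auto simp: gauss_rat_def)
  have efgh: "e \<in> gauss_rat" "f \<in> gauss_rat" "g \<in> gauss_rat" "h \<in> gauss_rat"
    using assms ring by auto
  show ?thesis
  proof
    have "magic_coordinates *v (magic_matrix e f g h *v u) = u" for u
      unfolding magic_coordinates_mult_vec magic_matrix_mult_vec
      by (simp add: vec4_eq_iff field_simps)
    then show "magic_coordinates ** magic_matrix e f g h = mat 1"
      by (simp add: matrix_eq flip: matrix_vector_mul_assoc)
    show "magic_matrix e f g h $ i $ k \<in> gauss_rat" for i k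
      using exhaust_4[of k]
      by (cases i) (auto simp: magic_matrix_def intro!: mult_mem ring efgh)
    show "magic_coordinates $ k $ i \<in> gauss_rat" for i k
      using exhaust_4[of k]
      by (cases i) (auto simp: magic_coordinates_def entry_vec_def ring)
  qed
qed

text \<open>
  For \<open>M = 0\<close> the eight lines give a linear system of rank six in the squares of the remaining entries,
  solved here in terms of \<open>A\<^sup>2\<close> and \<open>C\<^sup>2\<close>.
\<close>

lemma proj_point_in_magic_section:
  "proj_point x \<in> magic_variety \<inter> proj_zeros {Var eM} \<longleftrightarrow> x \<noteq> 0 \<and> x $ eM = 0 \<and>
     (x $ eB)\<^sup>2 = - (x $ eA)\<^sup>2 - (x $ eC)\<^sup>2 \<and> (x $ eD)\<^sup>2 = (x $ eC)\<^sup>2 - (x $ eA)\<^sup>2 \<and>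
     (x $ eE)\<^sup>2 = - (x $ eD)\<^sup>2 \<and> (x $ eF)\<^sup>2 = - (x $ eC)\<^sup>2 \<and>
     (x $ eG)\<^sup>2 = - (x $ eB)\<^sup>2 \<and> (x $ eH)\<^sup>2 = - (x $ eA)\<^sup>2"
proof -
  have num: "homogeneous 0 (numeral n :: entry cpoly)" for n
    using homogeneous_const[of "numeral n"] by (simp only: single_numeral)
  have line: "homogeneous (1 + 1) (magic_line a b c)" for a b c
  proof -
    have "homogeneous (0 + (1 + 1)) (3 * (Var eM * Var eM) :: entry cpoly)"
      by (rule homogeneous_mult[OF num homogeneous_mult[OF homogeneous_Var homogeneous_Var]])
    then have "homogeneous (1 + 1) (3 * (Var eM * Var eM) :: entry cpoly)"
      by (simp only: add_0)
    then show ?thesis unfolding magic_line_def power2_eq_square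
      by (rule homogeneous_diff[rotated]) (intro homogeneous_add homogeneous_mult homogeneous_Var)
  qed
  have "proj_point x \<in> magic_variety \<inter> proj_zeros {Var eM} \<longleftrightarrow> x \<noteq> 0 \<and> x $ eM = 0 \<and>
    (\<forall>f \<in> {magic_line eA eB eC, magic_line eD eM eE, magic_line eF eG eH,
     magic_line eA eD eF, magic_line eB eM eG, magic_line eC eE eH,
     magic_line eA eM eH, magic_line eC eM eF}. peval f x = 0)"
  proof -
    have "proj_point x \<in> proj_zeros {Var eM} \<longleftrightarrow> x \<noteq> 0 \<and> x $ eM = 0"
      using homogeneous_Var[of eM] by (subst proj_point_in_proj_zeros) auto
    moreover have "proj_point x \<in> magic_variety \<longleftrightarrow> x \<noteq> 0 \<and>
      (\<forall>f \<in> {magic_line eA eB eC, magic_line eD eM eE, magic_line eF eG eH,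
       magic_line eA eD eF, magic_line eB eM eG, magic_line eC eE eH,
       magic_line eA eM eH, magic_line eC eM eF}. peval f x = 0)"
      unfolding magic_variety_def using line by (subst proj_point_in_proj_zeros) blast+
    ultimately show ?thesis by blast
  qed
  also have "\<dots> \<longleftrightarrow> x \<noteq> 0 \<and> x $ eM = 0 \<and>
     (x $ eB)\<^sup>2 = - (x $ eA)\<^sup>2 - (x $ eC)\<^sup>2 \<and> (x $ eD)\<^sup>2 = (x $ eC)\<^sup>2 - (x $ eA)\<^sup>2 \<and>
     (x $ eE)\<^sup>2 = - (x $ eD)\<^sup>2 \<and> (x $ eF)\<^sup>2 = - (x $ eC)\<^sup>2 \<and>
     (x $ eG)\<^sup>2 = - (x $ eB)\<^sup>2 \<and> (x $ eH)\<^sup>2 = - (x $ eA)\<^sup>2"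
  proof (cases "x $ eM = 0")
    case True
    then have "peval (magic_line a b c) x = (x $ a)\<^sup>2 + (x $ b)\<^sup>2 + (x $ c)\<^sup>2" for a b c
      by (simp add: magic_line_def)
    moreover have "a + b + c = 0 \<and> d + 0 + e = 0 \<and> f + g + h = 0 \<and> a + d + f = 0 \<and> b + 0 + g = 0
        \<and> c + e + h = 0 \<and> a + 0 + h = 0 \<and> c + 0 + f = 0 \<longleftrightarrow>
        b = - a - c \<and> d = c - a \<and> e = - d \<and> f = - c \<and> g = - b \<and> h = - a"
      for a b c d e f g h :: complex
      by (rule iffI; elim conjE; intro conjI; algebra)
    ultimately show ?thesis using True by simp
  qed simp
  finally show ?thesis .
qed

text \<open>
  A relation such as \<open>E\<^sup>2 = -D\<^sup>2\<close> says \<open>E = \<i> D\<close> or \<open>E = -\<i> D\<close>. The other two relations become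
  the equations of \<open>quartic_cone\<close> in the coordinates \<open>magic_coordinates\<close>.
\<close>

lemma magic_section_decomposition:
  assumes "x \<noteq> 0"
  shows "proj_point x \<in> magic_variety \<inter> proj_zeros {Var eM} \<longleftrightarrow>
    (\<exists>e\<in>{\<i>, -\<i>}. \<exists>f\<in>{\<i>, -\<i>}. \<exists>g\<in>{\<i>, -\<i>}. \<exists>h\<in>{\<i>, -\<i>}. \<exists>u\<in>quartic_cone. x = magic_matrix e f g h *v u)"
proof
  assume "proj_point x \<in> magic_variety \<inter> proj_zeros {Var eM}"
  then have x: "x $ eM = 0" "(x $ eB)\<^sup>2 = - (x $ eA)\<^sup>2 - (x $ eC)\<^sup>2" "(x $ eD)\<^sup>2 = (x $ eC)\<^sup>2 - (x $ eA)\<^sup>2"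
     "(x $ eE)\<^sup>2 = - (x $ eD)\<^sup>2" "(x $ eF)\<^sup>2 = - (x $ eC)\<^sup>2"
     "(x $ eG)\<^sup>2 = - (x $ eB)\<^sup>2" "(x $ eH)\<^sup>2 = - (x $ eA)\<^sup>2"
    by (simp_all add: proj_point_in_magic_section del: Int_iff)
  have root: "\<exists>r\<in>{\<i>, -\<i>}. z = r * w" if "z\<^sup>2 = - w\<^sup>2" for z w :: complex
  proof -
    have "z\<^sup>2 = (\<i> * w)\<^sup>2" using that by (simp add: power_mult_distrib)
    then show ?thesis by (auto simp: power2_eq_iff)
  qed
  obtain e f g h where r: "e \<in> {\<i>, -\<i>}" "f \<in> {\<i>, -\<i>}" "g \<in> {\<i>, -\<i>}" "h \<in> {\<i>, -\<i>}"
    and eq: "x $ eE = e * x $ eD" "x $ eF = f * x $ eC" "x $ eG = g * x $ eB" "x $ eH = h * x $ eA"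
    using root[OF x(4)] root[OF x(5)] root[OF x(6)] root[OF x(7)] by blast
  let ?u = "magic_coordinates *v x"
  have "x = magic_matrix e f g h *v ?u"
    unfolding entry_eq_iff magic_matrix_mult_vec magic_coordinates_mult_vec
    by (simp add: x(1) eq field_simps)
  moreover have "?u \<in> quartic_cone"
  proof -
    have i2: "\<i>\<^sup>2 = -1" by simp
    let ?A = "x $ eA" and ?C = "x $ eC" and ?p = "\<i> * x $ eB + x $ eD" and ?m = "x $ eD - \<i> * x $ eB"
    have "4 * ?C\<^sup>2 - ?m\<^sup>2 = ?p\<^sup>2" using x(2,3) i2 by algebra
    moreover have "(?C / 2 - ?m / 4) * (?C / 2 + ?m / 4) = (4 * ?C\<^sup>2 - ?m\<^sup>2) / 16"
      by (simp only: power2_eq_square) (simp add: algebra_simps diff_divide_distrib)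
    moreover have "(- ?p / 4)\<^sup>2 = ?p\<^sup>2 / 16"
      by (simp only: power_divide power2_minus) simp
    ultimately have 1: "(?C / 2 - ?m / 4) * (?C / 2 + ?m / 4) = (- ?p / 4)\<^sup>2"
      by (simp only:)
    have "?A\<^sup>2 * 2 = - ?p * ?m" using x(2,3) i2 by algebra
    then have 2: "(?A / 2)\<^sup>2 = - ?p / 4 * (?C / 2 + ?m / 4 - (?C / 2 - ?m / 4))"
      by (simp add: power_divide mult.commute[of 2])
    from 1 2 show ?thesis
      unfolding quartic_cone_def mem_Collect_eq magic_coordinates_mult_vec vec4_nth by blast
  qed
  ultimately show "\<exists>e\<in>{\<i>, -\<i>}. \<exists>f\<in>{\<i>, -\<i>}. \<exists>g\<in>{\<i>, -\<i>}. \<exists>h\<in>{\<i>, -\<i>}. \<exists>u\<in>quartic_cone.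
      x = magic_matrix e f g h *v u"
    using r by blast
next
  assume "\<exists>e\<in>{\<i>, -\<i>}. \<exists>f\<in>{\<i>, -\<i>}. \<exists>g\<in>{\<i>, -\<i>}. \<exists>h\<in>{\<i>, -\<i>}. \<exists>u\<in>quartic_cone. x = magic_matrix e f g h *v u"
  then obtain e f g h u where r: "e \<in> {\<i>, -\<i>}" "f \<in> {\<i>, -\<i>}" "g \<in> {\<i>, -\<i>}" "h \<in> {\<i>, -\<i>}"
    and u: "u \<in> quartic_cone" and x: "x = magic_matrix e f g h *v u" by blast
  have sq: "e\<^sup>2 = -1" "f\<^sup>2 = -1" "g\<^sup>2 = -1" "h\<^sup>2 = -1" "\<i>\<^sup>2 = -1" using r by auto
  have u': "u $ 1 * u $ 4 = (u $ 2)\<^sup>2" "(u $ 3)\<^sup>2 = u $ 2 * (u $ 4 - u $ 1)"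
    using u by (simp_all add: quartic_cone_def)
  have "(\<i> * (u $ 4 + 2 * u $ 2 - u $ 1))\<^sup>2 = - (2 * u $ 3)\<^sup>2 - (u $ 4 + u $ 1)\<^sup>2"
       "(u $ 4 - 2 * u $ 2 - u $ 1)\<^sup>2 = (u $ 4 + u $ 1)\<^sup>2 - (2 * u $ 3)\<^sup>2"
    using u' sq(5) by algebra+
  then show "proj_point x \<in> magic_variety \<inter> proj_zeros {Var eM}"
    unfolding proj_point_in_magic_section using assms
    by (simp add: x magic_matrix_mult_vec power_mult_distrib sq)
qed

definition magic_curve :: "complex \<times> complex \<times> complex \<times> complex \<Rightarrow> (complex ^ entry) set set" where
  "magic_curve = (\<lambda>(e, f, g, h). quartic_curve (magic_matrix e f g h))"

abbreviation sign_choices :: "(complex \<times> complex \<times> complex \<times> complex) set" where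
  "sign_choices \<equiv> {\<i>, -\<i>} \<times> {\<i>, -\<i>} \<times> {\<i>, -\<i>} \<times> {\<i>, -\<i>}"

text \<open>
  The parameters are ratios of entries, so they can be read off from any single point of the curve at
  which \<open>A\<close>, \<open>B\<close>, \<open>C\<close>, \<open>D\<close> are all nonzero.
\<close>

lemma inj_magic_curve: "inj_on magic_curve sign_choices"
proof (rule inj_onI)
  fix s t assume st: "s \<in> sign_choices" "t \<in> sign_choices" "magic_curve s = magic_curve t"
  obtain e f g h where s: "s = (e, f, g, h)" by (cases s)
  obtain e' f' g' h' where t: "t = (e', f', g', h')" by (cases t)
  have r: "e \<in> {\<i>, -\<i>}" "f \<in> {\<i>, -\<i>}" "g \<in> {\<i>, -\<i>}" "h \<in> {\<i>, -\<i>}"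
    "e' \<in> {\<i>, -\<i>}" "f' \<in> {\<i>, -\<i>}" "g' \<in> {\<i>, -\<i>}" "h' \<in> {\<i>, -\<i>}"
    using st(1,2) unfolding s t by blast+
  have eq: "magic_curve (e, f, g, h) = magic_curve (e', f', g', h')"
    using st(3) unfolding s t .
  interpret M: quartic_model_over "magic_matrix e f g h" magic_coordinates gauss_rat
    by (rule quartic_model_over_magic_matrix) (use r in simp)
  interpret M': quartic_model_over "magic_matrix e' f' g' h'" magic_coordinates gauss_rat
    by (rule quartic_model_over_magic_matrix) (use r in simp)
  \<comment> \<open>The point \<open>(2, y)\<close> of the cubic has \<open>A = 2 y\<close>, \<open>B = 7 \<i>\<close>, \<open>C = 5\<close>, \<open>D = -1\<close>.\<close>
  define y where "y = csqrt 6"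
  have y: "y\<^sup>2 = 2 ^ 3 - 2" by (simp only: y_def power2_csqrt) simp
  then have y0: "y \<noteq> 0" by auto
  let ?x = "magic_matrix e f g h *v affine_vec 2 y"
  have "proj_point ?x \<in> magic_curve (e', f', g', h')"
    unfolding eq[symmetric] unfolding magic_curve_def
    by (simp add: M.proj_point_in_quartic_curve affine_vec_in_cone y)
  then obtain u where "u \<in> quartic_cone" "?x = magic_matrix e' f' g' h' *v u"
    using M'.quartic_curveE[OF _ proj_point_self] unfolding magic_curve_def by auto
  then have u: "?x $ i = (magic_matrix e' f' g' h' *v u) $ i" for i by simp
  have A: "u $ 3 = y" and B: "u $ 4 + 2 * u $ 2 - u $ 1 = 7" and C: "u $ 4 + u $ 1 = 5"
    and D: "u $ 4 - 2 * u $ 2 - u $ 1 = - 1"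
    using u[of eA] u[of eB] u[of eC] u[of eD] by (simp_all add: magic_matrix_mult_vec affine_vec_nth)
  show "s = t" unfolding s t
    using u[of eE] u[of eF] u[of eG] u[of eH] y0
    unfolding magic_matrix_mult_vec A B C D by (simp add: affine_vec_nth)
qed

theorem proposition3p3:
  shows "\<exists>\<C>. card \<C> = 16 \<and>
    magic_variety \<inter> proj_zeros {Var eM} = \<Union>\<C> \<and>
    (\<forall>C\<in>\<C>. elliptic_curve gauss_rat C \<and> isomorphic_over gauss_rat C weierstrass_curve)"
proof (intro exI[of _ "magic_curve ` sign_choices"] conjI)
  have "card sign_choices = 16" by (simp add: card_cartesian_product)
  then show "card (magic_curve ` sign_choices) = 16"
    using card_image[OF inj_magic_curve] by simp
  have model: "quartic_model_over (magic_matrix e f g h) magic_coordinates gauss_rat"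
    if "(e, f, g, h) \<in> sign_choices" for e f g h
    by (rule quartic_model_over_magic_matrix) (use that in auto)
  show "magic_variety \<inter> proj_zeros {Var eM} = \<Union> (magic_curve ` sign_choices)"
  proof (intro equalityI subsetI)
    fix P assume P: "P \<in> magic_variety \<inter> proj_zeros {Var eM}"
    then have "P \<in> proj_space" by (simp add: proj_zeros_def)
    then obtain x where x: "x \<noteq> 0" "P = proj_point x" by (rule proj_spaceE)
    obtain e f g h u where "(e, f, g, h) \<in> sign_choices" "u \<in> quartic_cone"
      and u: "x = magic_matrix e f g h *v u"
      using P unfolding x(2) magic_section_decomposition[OF x(1)] by blast
    moreover have "u \<noteq> 0" using x(1) u by auto
    ultimately have "P \<in> magic_curve (e, f, g, h)"
      unfolding x(2) u magic_curve_def quartic_curve_def prod.case by blast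
    with \<open>(e, f, g, h) \<in> sign_choices\<close> show "P \<in> \<Union> (magic_curve ` sign_choices)" by blast
  next
    fix P assume "P \<in> \<Union> (magic_curve ` sign_choices)"
    then obtain e f g h where s: "(e, f, g, h) \<in> sign_choices" and "P \<in> magic_curve (e, f, g, h)"
      by blast
    then obtain u where u: "u \<in> quartic_cone" "u \<noteq> 0" "P = proj_point (magic_matrix e f g h *v u)"
      by (auto simp: magic_curve_def quartic_curve_def)
    interpret quartic_model_over "magic_matrix e f g h" magic_coordinates gauss_rat
      by (rule model[OF s])
    have "magic_matrix e f g h *v u \<noteq> 0" using u(2) by simp
    then show "P \<in> magic_variety \<inter> proj_zeros {Var eM}"
      unfolding u(3) magic_section_decomposition[OF \<open>magic_matrix e f g h *v u \<noteq> 0\<close>]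
      using s u(1) by blast
  qed
  show "\<forall>C\<in>magic_curve ` sign_choices.
      elliptic_curve gauss_rat C \<and> isomorphic_over gauss_rat C weierstrass_curve"
  proof
    fix C assume "C \<in> magic_curve ` sign_choices"
    then obtain e f g h where s: "(e, f, g, h) \<in> sign_choices" and C: "C = quartic_curve (magic_matrix e f g h)"
      unfolding magic_curve_def by blast
    interpret quartic_model_over "magic_matrix e f g h" magic_coordinates gauss_rat
      by (rule model[OF s])
    show "elliptic_curve gauss_rat C \<and> isomorphic_over gauss_rat C weierstrass_curve"
      unfolding C using elliptic_curve_quartic_curve isomorphic_weierstrass_curve by blast
  qed
qed

end
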